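(* Let $P\subset\mathbb{R}^d$ be a $d$-dimensional simple rational polytope with vertex set $V$. Then for almost all $z\in\mathbb{C}^d$ and all real $t>0$: (a) for each $0 \le m \le d-1$, $$0 = \sum_{k=0}^m \binom{m}{k} \sum_{v\in V} B_k\big(t\langle v,z\rangle, \mathbf{a}_v\big) \sum_{q\in(\mathbb{Z}^d - tv)\cap\Pi_v} \langle q,z\rangle^{m-k};$$ (b) equivalently, for each pair $(m,r)$ with $0\le m\le d-1$ and $0\le r\le m$, $$0 = \sum_{v\in V} \langle v,z\rangle^r \sum_{j=0}^{m-r} \frac{B_j(\mathbf{a}_v)}{j!\,(m-r-j)!} \sum_{q\in(\mathbb{Z}^d - tv)\cap\Pi_v}\langle q, z\rangle^{m-r-j}.$$
   Context: A polytope is simple if each vertex lies on exactly $d$ edges. For each vertex $v$ of $P$, let $w_1(v),\dots,w_d(v)$ be the primitive integer vectors (gcd of coordinates equal to $1$) along the $d$ edges emanating from $v$, and $\Pi_v := \{\sum_{k=1}^d \lambda_k w_k(v) : 0 \le \lambda_k < 1\}$. For $z\in\mathbb{C}^d$, $\langle x,z\rangle := \sum_m x_m z_m$ (no conjugation). Set $\mathbf{a}_v := (\langle w_1(v), z\rangle,\dots,\langle w_d(v),z\rangle)$. For $\mathbf{a}\in\mathbb{C}^d$ with all $a_j\ne0$, Barnes polynomials are defined by $\frac{x^d e^{tx}}{\prod_{j=1}^d (e^{a_jx}-1)} = \sum_{k\ge0}B_k(t,\mathbf{a})\frac{x^k}{k!}$ near $x=0$, and Barnes numbers by $B_k(\mathbf{a})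 := B_k(0,\mathbf{a})$. The sum over $q\in(\mathbb{Z}^d - tv)\cap\Pi_v$ runs over points of the translated lattice $\mathbb{Z}^d - tv$ lying in $\Pi_v$; $\langle q,z\rangle^0 = 1$. "For almost all $z$" means for all $z$ with $\langle z, w_k(v)\rangle\notin 2\pi i\mathbb{Z}$ for every vertex $v$ and every $k$. *)

theory Defs
  imports "HOL-Analysis.Analysis"
begin

text \<open>The bilinear pairing of a real with a complex vector; no conjugation.\<close>
definition pairing :: "real ^ 'd \<Rightarrow> complex ^ 'd \<Rightarrow> complex" where
  "pairing x z = (\<Sum>m\<in>UNIV. of_real (x $ m) * z $ m)"

definition vertices :: "'a::euclidean_space set \<Rightarrow> 'a set" where
  "vertices P = {v. v extreme_point_of P}"

definition edges_at :: "'a::euclidean_space set \<Rightarrow> 'a \<Rightarrow> 'a set set" where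
  "edges_at P v = {e. e edge_of P \<and> v \<in> e}"

definition simple_polytope :: "'a::euclidean_space set \<Rightarrow> bool" where
  "simple_polytope P \<longleftrightarrow>
     polytope P \<and> (\<forall>v\<in>vertices P. finite (edges_at P v) \<and> int (card (edges_at P v)) = aff_dim P)"

definition rational_polytope :: "(real ^ 'd) set \<Rightarrow> bool" where
  "rational_polytope P \<longleftrightarrow> polytope P \<and> (\<forall>v\<in>vertices P. \<forall>i. v $ i \<in> \<rat>)"

definition integer_lattice :: "(real ^ 'd) set" where
  "integer_lattice = {x. \<forall>i. x $ i \<in> \<int>}"

definition primitive_vector :: "real ^ 'd \<Rightarrow> bool" where
  "primitive_vector w \<longleftrightarrow>
     (\<exists>u :: int ^ 'd. w = (\<chi> i. of_int (u $ i)) \<and> Gcd (range (\<lambda>i. u $ i)) = 1)"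

text \<open>The primitive vector along the edge \<open>e\<close>, pointing away from its endpoint \<open>v\<close>;
  it exists and is unique when both endpoints of \<open>e\<close> are rational.\<close>
definition primitive_edge_vector :: "real ^ 'd \<Rightarrow> (real ^ 'd) set \<Rightarrow> real ^ 'd" where
  "primitive_edge_vector v e = (THE w. primitive_vector w \<and> (\<exists>c>0. v + c *\<^sub>R w \<in> e))"

text \<open>\<open>W\<close> lists the primitive vectors along the edges emanating from \<open>v\<close>, in an arbitrary
  order; the labels are the elements of the coordinate type \<open>'d\<close> instead of \<open>1, \<dots>, d\<close>.\<close>
definition primitive_edge_family ::
  "(real ^ 'd) set \<Rightarrow> real ^ 'd \<Rightarrow> ('d \<Rightarrow> real ^ 'd) \<Rightarrow> bool" where
  "primitive_edge_family P v W \<longleftrightarrow>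
     (\<exists>\<epsilon>. bij_betw \<epsilon> UNIV (edges_at P v) \<and> (\<forall>k. W k = primitive_edge_vector v (\<epsilon> k)))"

definition parallelepiped :: "('d::finite \<Rightarrow> real ^ 'd) \<Rightarrow> (real ^ 'd) set" where
  "parallelepiped W = {(\<Sum>k\<in>UNIV. c k *\<^sub>R W k) | c. \<forall>k. 0 \<le> c k \<and> c k < 1}"

definition translated_lattice_points ::
  "real \<Rightarrow> real ^ 'd \<Rightarrow> ('d::finite \<Rightarrow> real ^ 'd) \<Rightarrow> (real ^ 'd) set" where
  "translated_lattice_points t v W =
     (\<lambda>x. x - t *\<^sub>R v) ` integer_lattice \<inter> parallelepiped W"

definition edge_pairings :: "('d \<Rightarrow> real ^ 'd) \<Rightarrow> complex ^ 'd \<Rightarrow> complex ^ 'd" where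
  "edge_pairings W z = (\<chi> k. pairing (W k) z)"

text \<open>The punctured filter \<^term>\<open>at (0::complex)\<close> avoids the removable singularity of the
  generating function at \<open>0\<close>. The coefficient sequence is well defined when all entries
  of \<open>a\<close> are nonzero.\<close>
definition barnes_poly :: "nat \<Rightarrow> complex \<Rightarrow> complex ^ 'n \<Rightarrow> complex" where
  "barnes_poly k t a =
     (THE B :: nat \<Rightarrow> complex. \<forall>\<^sub>F x in at 0.
        (\<lambda>j. B j * (x ^ j / fact j)) sums
          (x ^ CARD('n) * exp (t * x) / (\<Prod>j\<in>UNIV. exp (a $ j * x) - 1))) k"

definition barnes_number :: "nat \<Rightarrow> complex ^ 'n \<Rightarrow> complex" where
  "barnes_number k a = barnes_poly k 0 a"

end

theory Submission
  imports Defs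
begin

text \<open>
  Up to the factor \<open>m!\<close>, (a) says that the coefficient of \<open>x^m\<close> vanishes in the sum over the vertices
  \<open>v\<close> of \<open>T v = (\<Sum>n. exp (\<langle>n,z\<rangle>x)) \<cdot> (\<Prod>k. x / (exp (\<langle>w_k(v),z\<rangle>x) - 1))\<close>, where \<open>n\<close> runs over
  the lattice points of \<open>tv + \<Pi>_v\<close>. No lattice points of \<open>tP\<close> are counted; instead the poles in \<open>z\<close>
  are shown to cancel. Replace \<open>z\<close> by \<open>z + s y\<close> with \<open>y\<close> generic. The coefficient of \<open>x^m\<close> in
  \<open>T v\<close> becomes a rational function of \<open>s\<close> whose numerator has degree at most \<open>m < d\<close> and which has
  \<open>d\<close> simple poles, one for each edge at \<open>v\<close>, so it is the sum of its partial fractions. The poles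
  that an edge \<open>[u, v]\<close> with primitive vector \<open>w\<close> contributes at \<open>u\<close> and at \<open>v\<close> agree, and the two
  residues are opposite: on the hyperplane \<open>\<langle>w,z\<rangle> = 0\<close> the residue depends only on the image of the
  cone modulo \<open>\<real>w\<close>, which is the same for both endpoints, while the linear factor changes its
  sign.

  For (b), replace \<open>t\<close> by \<open>t + nN\<close> with \<open>N\<close> a common denominator of the vertices. This changes
  none of the translated lattices, so (a) becomes a polynomial identity in \<open>n\<close>, and (b) states that
  its coefficients vanish.
\<close>

section \<open>Barnes polynomials as formal power series\<close>

text \<open>The series of \<open>(exp (a * x) - 1) / x\<close>: the shift drops the constant term 1
  and divides by x. Its constant term is \<open>a\<close>, so it is invertible exactly for nonzero
  \<open>a\<close>.\<close>

definition exp_quot :: "complex \<Rightarrow> complex fps" where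
  "exp_quot a = fps_shift 1 (fps_exp a)"

lemma exp_quot_nth: "fps_nth (exp_quot a) n = a ^ Suc n / fact (Suc n)"
  by (simp add: exp_quot_def algebra_simps)

lemma fps_X_mult_exp_quot: "fps_X * exp_quot a = fps_exp a - 1"
proof (rule fps_ext)
  show "fps_nth (fps_X * exp_quot a) n = fps_nth (fps_exp a - 1) n" for n
    by (cases n) (simp_all add: exp_quot_nth del: fact_Suc)
qed

lemma exp_quot_has_fps_expansion:
  "(\<lambda>x. if x = 0 then a else (exp (a * x) - 1) / x) has_fps_expansion exp_quot a"
\<comment> \<open>The zero series has subdegree 0, so the shift argument is confined to nonzero
  \<open>a\<close>.\<close>
proof (cases "a = 0")
  case True
  then have "exp_quot a = 0" by (intro fps_ext) (simp add: exp_quot_nth)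
  moreover have "(\<lambda>x. if x = 0 then a else (exp (a * x) - 1) / x) = (\<lambda>x. 0)"
    using True by auto
  ultimately show ?thesis by simp
next
  case False
  have sub: "1 \<le> subdegree (fps_exp a - 1)"
    using False by (intro subdegree_geI) auto
  have "(\<lambda>x. if x = 0 then a else (exp (a * x) - 1) / x ^ 1)
          has_fps_expansion fps_shift 1 (fps_exp a - 1)"
    using sub by (intro has_fps_expansion_shift has_fps_expansion_diff has_fps_expansion_exp
          has_fps_expansion_1) auto
  also have "fps_shift 1 (fps_exp a - 1) = exp_quot a"
    by (rule fps_ext) (simp add: exp_quot_def)
  finally show ?thesis by (simp only: power_one_right)
qed

text \<open>The power series of \<open>a x / (exp (a x) - 1)\<close>, written so that it also covers \<open>a = 0\<close>
  and has a coefficient homogeneous in \<open>a\<close> in each degree.\<close>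
definition todd_series :: "complex \<Rightarrow> complex fps" where
  "todd_series a = Abs_fps (\<lambda>n. a ^ n * fps_nth (inverse (exp_quot 1)) n)"

lemma todd_series_0: "todd_series 0 = 1"
  by (rule fps_ext) (auto simp: todd_series_def exp_quot_nth)

text \<open>Every summand of the n-th Cauchy coefficient carries the same power
  \<open>a ^ Suc n\<close>. This reduces the identity to \<open>a = 1\<close>, where the two factors
  are mutually inverse.\<close>

lemma todd_series_mult_exp_quot: "todd_series a * exp_quot a = fps_const a"
proof (rule fps_ext)
  fix n
  have "fps_nth (todd_series a * exp_quot a) n
      = a ^ Suc n * fps_nth (inverse (exp_quot 1) * exp_quot 1) n"
    unfolding fps_mult_nth sum_distrib_left
  proof (rule sum.cong)
    fix i assume "i \<in> {0..n}"
    then have "a ^ i * a ^ Suc (n - i) = a ^ Suc n"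
      by (simp flip: power_add power_Suc)
    moreover have "fps_nth (todd_series a) i * fps_nth (exp_quot a) (n - i) =
        (a ^ i * a ^ Suc (n - i)) * (fps_nth (inverse (exp_quot 1)) i * fps_nth (exp_quot 1) (n - i))"
      by (simp add: todd_series_def exp_quot_nth)
    ultimately show "fps_nth (todd_series a) i * fps_nth (exp_quot a) (n - i) =
        a ^ Suc n * (fps_nth (inverse (exp_quot 1)) i * fps_nth (exp_quot 1) (n - i))"
      by (simp only:)
  qed simp
  also have "inverse (exp_quot 1) * exp_quot 1 = 1"
    by (rule inverse_mult_eq_1) (simp add: exp_quot_nth)
  finally show "fps_nth (todd_series a * exp_quot a) n = fps_nth (fps_const a) n"
    by simp
qed

lemma todd_series_eq:
  assumes "a \<noteq> 0"
  shows "todd_series a = fps_const a * inverse (exp_quot a)"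
proof -
  have "exp_quot a * inverse (exp_quot a) = 1"
    using assms by (intro inverse_mult_eq_1') (simp add: exp_quot_nth)
  then have "todd_series a = todd_series a * exp_quot a * inverse (exp_quot a)"
    by (simp add: mult.assoc)
  then show ?thesis by (simp add: todd_series_mult_exp_quot)
qed

section \<open>From the analytic definition to formal power series\<close>

text \<open>Giving the sum its value \<open>B 0\<close> at 0 turns \<open>B\<close> into a genuine
  expansion; continuity of both functions at 0 forces \<open>B 0 = f 0\<close>, and expansions are
  unique. This handles the punctured filter in \<open>barnes_poly\<close>.\<close>

lemma fps_expansion_unique_punctured:
  fixes f :: "complex \<Rightarrow> complex"
  assumes f: "f has_fps_expansion F"
    and B: "\<forall>\<^sub>F x in at 0. (\<lambda>j. B j * x ^ j) sums f x"
  shows "B = fps_nth F"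
proof -
  define G where "G = Abs_fps B"
  have "\<forall>\<^sub>F x in nhds 0. (\<lambda>j. fps_nth G j * x ^ j) sums (if x = 0 then B 0 else f x)"
    unfolding eventually_nhds_conv_at
  proof
    show "\<forall>\<^sub>F x in at 0. (\<lambda>j. fps_nth G j * x ^ j) sums (if x = 0 then B 0 else f x)"
      using B by (simp add: G_def eventually_at_filter)
    show "(\<lambda>j. fps_nth G j * 0 ^ j) sums (if (0::complex) = 0 then B 0 else f 0)"
      using powser_sums_zero[of B] by (simp add: G_def)
  qed
  then have G: "(\<lambda>x. if x = 0 then B 0 else f x) has_fps_expansion G"
    by (rule has_fps_expansionI)
  have "((\<lambda>x. if x = 0 then B 0 else f x) \<longlongrightarrow> B 0) (at 0)" "(f \<longlongrightarrow> f 0) (at 0)"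
    using has_fps_expansion_imp_continuous[OF G, of UNIV]
      has_fps_expansion_imp_continuous[OF f, of UNIV]
    by (auto simp: continuous_at_imp_continuous_at_within continuous_within)
  moreover have "\<forall>\<^sub>F x in at 0. (if x = 0 then B 0 else f x) = f x"
    by (simp add: eventually_at_filter)
  ultimately have "B 0 = f 0"
    using tendsto_cong[of "\<lambda>x. if x = 0 then B 0 else f x" f "at 0" "B 0"]
      LIM_unique[of f "B 0" 0 "f 0"] by simp
  then have "(\<lambda>x. if x = 0 then B 0 else f x) = f" by auto
  with G have "f has_fps_expansion G" by simp
  then have "G = F"
    using f unfolding has_fps_expansion_def
    by (intro eval_fps_eqD) (auto elim: eventually_elim2)
  then show ?thesis by (auto simp: G_def)
qed

text \<open>One factor x of \<open>x ^ CARD('n)\<close> goes to each denominator and removes its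
  zero at 0. With this lemma the description operator and convergence are gone; all later
  computations are in \<open>complex fps\<close>.\<close>

lemma barnes_poly_eq_fps_nth:
  fixes a :: "complex ^ 'n"
  assumes a: "\<And>j. a $ j \<noteq> 0"
  shows "barnes_poly k t a =
    fact k * fps_nth (fps_exp t * (\<Prod>j\<in>UNIV. inverse (exp_quot (a $ j)))) k"
proof -
  define F where "F = fps_exp t * (\<Prod>j\<in>UNIV. inverse (exp_quot (a $ j)))"
  define f where "f = (\<lambda>x. exp (t * x) *
    (\<Prod>j\<in>UNIV. inverse (if x = 0 then a $ j else (exp (a $ j * x) - 1) / x)))"
  have f: "f has_fps_expansion F"
    unfolding f_def F_def
    by (intro has_fps_expansion_mult has_fps_expansion_exp has_fps_expansion_prod
        has_fps_expansion_inverse exp_quot_has_fps_expansion) (simp add: a exp_quot_nth)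
  have eq: "x ^ CARD('n) * exp (t * x) / (\<Prod>j\<in>UNIV. exp (a $ j * x) - 1) = f x"
    if "x \<noteq> 0" for x
    using that by (simp add: f_def prod_dividef prod_inversef[symmetric] field_simps
        flip: prod_inversef)
  have ev: "\<forall>\<^sub>F x in at 0. x \<noteq> (0::complex)"
    by (simp add: eventually_at_filter)
  have sums: "(\<forall>\<^sub>F x in at 0. (\<lambda>j. B j * (x ^ j / fact j)) sums
      (x ^ CARD('n) * exp (t * x) / (\<Prod>j\<in>UNIV. exp (a $ j * x) - 1))) \<longleftrightarrow>
     (\<forall>\<^sub>F x in at 0. (\<lambda>j. B j / fact j * x ^ j) sums f x)" for B
    by (rule eventually_cong[OF ev]) (simp add: eq)
  have "(THE B. \<forall>\<^sub>F x in at 0. (\<lambda>j. B j * (x ^ j / fact j)) sums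
      (x ^ CARD('n) * exp (t * x) / (\<Prod>j\<in>UNIV. exp (a $ j * x) - 1)))
    = (\<lambda>k. fact k * fps_nth F k)"
    unfolding sums
  proof (rule the_equality)
    have "\<forall>\<^sub>F x in nhds 0. x \<in> eball 0 (fps_conv_radius F)"
      using f by (intro eventually_nhds_in_open) (auto simp: has_fps_expansion_def zero_ereal_def)
    moreover have "\<forall>\<^sub>F x in nhds 0. eval_fps F x = f x"
      using f by (simp add: has_fps_expansion_def)
    ultimately have "\<forall>\<^sub>F x in nhds 0. (\<lambda>j. fps_nth F j * x ^ j) sums f x"
      by eventually_elim (metis in_eball_iff dist_0_norm sums_eval_fps)
    then show "\<forall>\<^sub>F x in at 0. (\<lambda>j. fact j * fps_nth F j / fact j * x ^ j) sums f x"
      by (simp add: eventually_nhds_conv_at)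
  next
    fix B assume "\<forall>\<^sub>F x in at 0. (\<lambda>j. B j / fact j * x ^ j) sums f x"
    from fps_expansion_unique_punctured[OF f this]
    show "B = (\<lambda>k. fact k * fps_nth F k)"
      by (metis (no_types) fact_nonzero nonzero_mult_div_cancel_left times_divide_eq_right)
  qed
  then show ?thesis by (simp add: barnes_poly_def F_def)
qed

section \<open>Lattice points of half-open parallelepipeds\<close>

lemma pairing_add_left: "pairing (x + y) z = pairing x z + pairing y z"
  by (simp add: pairing_def sum.distrib distrib_right)

lemma pairing_scaleR_left: "pairing (c *\<^sub>R x) z = of_real c * pairing x z"
  by (simp add: pairing_def sum_distrib_left mult.assoc)

lemma pairing_minus_left: "pairing (- x) z = - pairing x z"
  using pairing_scaleR_left[of "-1" x z] by simp

lemma pairing_add_smult_right: "pairing x (z + s *s y) = pairing x z + s * pairing x y"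
  by (simp add: pairing_def sum.distrib sum_distrib_left algebra_simps)

lemma integer_lattice_add: "x \<in> integer_lattice \<Longrightarrow> y \<in> integer_lattice \<Longrightarrow> x + y \<in> integer_lattice"
  by (simp add: integer_lattice_def)

lemma integer_lattice_diff: "x \<in> integer_lattice \<Longrightarrow> y \<in> integer_lattice \<Longrightarrow> x - y \<in> integer_lattice"
  by (simp add: integer_lattice_def)

lemma integer_lattice_scaleR:
  "x \<in> integer_lattice \<Longrightarrow> c \<in> \<int> \<Longrightarrow> c *\<^sub>R x \<in> integer_lattice"
  by (simp add: integer_lattice_def)

section \<open>Independent families and half-open cells\<close>

text \<open>Independence of the indexed family rather than of its range: a repeated vector counts as
  a dependence, and coefficients are compared label by label.\<close>

definition indep_family :: "('k::finite \<Rightarrow> 'a::real_vector) \<Rightarrow> bool" where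
  "indep_family W \<longleftrightarrow> (\<forall>c. (\<Sum>k\<in>UNIV. c k *\<^sub>R W k) = 0 \<longrightarrow> (\<forall>k. c k = 0))"

lemma indep_familyD: "indep_family W \<Longrightarrow> (\<Sum>k\<in>UNIV. c k *\<^sub>R W k) = 0 \<Longrightarrow> c k = 0"
  unfolding indep_family_def by blast

lemma indep_family_unique:
  assumes "indep_family W" "(\<Sum>k\<in>UNIV. c k *\<^sub>R W k) = (\<Sum>k\<in>UNIV. d k *\<^sub>R W k)"
  shows "c k = d k"
proof -
  have "(\<Sum>k\<in>UNIV. (c k - d k) *\<^sub>R W k) = 0"
    using assms(2) by (simp add: scaleR_diff_left sum_subtractf)
  from indep_familyD[OF assms(1) this] show ?thesis by (metis eq_iff_diff_eq_0)
qed

lemma indep_family_scale: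
  fixes \<alpha> :: "'k::finite \<Rightarrow> real"
  assumes W: "indep_family W" and \<alpha>: "\<And>k. \<alpha> k \<noteq> 0"
  shows "indep_family (\<lambda>k. \<alpha> k *\<^sub>R W k)"
  unfolding indep_family_def
proof (intro allI impI)
  fix c k assume "(\<Sum>k\<in>UNIV. c k *\<^sub>R \<alpha> k *\<^sub>R W k) = 0"
  then have "(\<Sum>k\<in>UNIV. (c k * \<alpha> k) *\<^sub>R W k) = 0" by simp
  from indep_familyD[OF W this, of k] \<alpha> show "c k = 0" by simp
qed

lemma indep_family_reindex:
  assumes W: "indep_family W" and \<sigma>: "bij \<sigma>"
  shows "indep_family (W \<circ> \<sigma>)"
  unfolding indep_family_def
proof (intro allI impI)
  fix c k assume "(\<Sum>k\<in>UNIV. c k *\<^sub>R (W \<circ> \<sigma>) k) = 0"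
  moreover have "(\<Sum>k\<in>UNIV. c k *\<^sub>R (W \<circ> \<sigma>) k) = (\<Sum>k\<in>UNIV. c (inv \<sigma> k) *\<^sub>R W k)"
    using sum.reindex_bij_betw[OF \<sigma>, of "\<lambda>k. c (inv \<sigma> k) *\<^sub>R W k"] \<sigma>
    by (simp add: bij_def inv_f_f)
  ultimately have "c (inv \<sigma> (\<sigma> k)) = 0"
    by (metis indep_familyD[OF W])
  then show "c k = 0" using \<sigma> by (simp add: bij_def inv_f_f)
qed

text \<open>Moving by a multiple of one generator becomes an update of one coefficient, the form in
  which \<open>indep_family_unique\<close> compares coordinates.\<close>

lemma sum_scaleR_upd_add:
  fixes W :: "'k::finite \<Rightarrow> 'a::real_vector"
  shows "(\<Sum>k\<in>UNIV. (c(j := c j + x)) k *\<^sub>R W k) = (\<Sum>k\<in>UNIV. c k *\<^sub>R W k) + x *\<^sub>R W j"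
proof -
  have "(c(j := c j + x)) k *\<^sub>R W k = c k *\<^sub>R W k + (if k = j then x *\<^sub>R W j else 0)" for k
    by (simp add: scaleR_add_left)
  then show ?thesis by (simp add: sum.distrib)
qed

text \<open>The lattice points of the cell at \<open>p\<close> are not translated back to the
  origin, so that cells with different \<open>p\<close> can be compared inside one fixed
  lattice.\<close>

definition box_points :: "real ^ 'd \<Rightarrow> ('d::finite \<Rightarrow> real ^ 'd) \<Rightarrow> (real ^ 'd) set" where
  "box_points p W = {n \<in> integer_lattice. n - p \<in> parallelepiped W}"

text \<open>For independent integral \<open>W\<close>, multiplying by the inverses of all
  \<open>exp_quot (pairing (W k) \<zeta>)\<close> gives, up to sign and a power of x, the
  integer-point transform of the cone with apex \<open>p\<close> and generators
  \<open>W\<close>.\<close>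

definition box_gf :: "real ^ 'd \<Rightarrow> ('d::finite \<Rightarrow> real ^ 'd) \<Rightarrow> complex ^ 'd \<Rightarrow> complex fps" where
  "box_gf p W \<zeta> = (\<Sum>n\<in>box_points p W. fps_exp (pairing n \<zeta>))"

lemma box_pointsI:
  assumes "n \<in> integer_lattice" "n = p + (\<Sum>k\<in>UNIV. c k *\<^sub>R W k)" "\<And>k. 0 \<le> c k" "\<And>k. c k < 1"
  shows "n \<in> box_points p W"
  using assms by (auto simp: box_points_def parallelepiped_def)

lemma box_pointsE:
  assumes "n \<in> box_points p W"
  obtains c where "n \<in> integer_lattice" "n = p + (\<Sum>k\<in>UNIV. c k *\<^sub>R W k)"
    "\<forall>k. 0 \<le> c k" "\<forall>k. c k < 1"
proof -
  from assms obtain c where "n - p = (\<Sum>k\<in>UNIV. c k *\<^sub>R W k)" "\<forall>k. 0 \<le> c k \<and> c k < 1"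
      "n \<in> integer_lattice"
    by (auto simp: box_points_def parallelepiped_def)
  with that[of c] show ?thesis by (simp add: algebra_simps)
qed

lemma box_gf_reindex:
  assumes \<sigma>: "bij \<sigma>"
  shows "box_gf p (W \<circ> \<sigma>) \<zeta> = box_gf p W \<zeta>"
proof -
  have "parallelepiped (W \<circ> \<sigma>) = parallelepiped W"
  proof (intro equalityI subsetI)
    fix x assume "x \<in> parallelepiped (W \<circ> \<sigma>)"
    then obtain c where c: "x = (\<Sum>k\<in>UNIV. c k *\<^sub>R W (\<sigma> k))" "\<forall>k. 0 \<le> c k \<and> c k < 1"
      by (auto simp: parallelepiped_def)
    have "x = (\<Sum>k\<in>UNIV. c (inv \<sigma> k) *\<^sub>R W k)"
      using sum.reindex_bij_betw[OF \<sigma>, of "\<lambda>k. c (inv \<sigma> k) *\<^sub>R W k"] \<sigma> c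
      by (simp add: bij_def inv_f_f)
    with c(2) show "x \<in> parallelepiped W"
      unfolding parallelepiped_def by (intro CollectI exI[of _ "\<lambda>k. c (inv \<sigma> k)"]) auto
  next
    fix x assume "x \<in> parallelepiped W"
    then obtain c where c: "x = (\<Sum>k\<in>UNIV. c k *\<^sub>R W k)" "\<forall>k. 0 \<le> c k \<and> c k < 1"
      by (auto simp: parallelepiped_def)
    then have "x = (\<Sum>k\<in>UNIV. c (\<sigma> k) *\<^sub>R (W \<circ> \<sigma>) k)"
      using sum.reindex_bij_betw[OF \<sigma>, of "\<lambda>k. c k *\<^sub>R W k"] by simp
    with c(2) show "x \<in> parallelepiped (W \<circ> \<sigma>)"
      unfolding parallelepiped_def by (intro CollectI exI[of _ "\<lambda>k. c (\<sigma> k)"]) auto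
  qed
  then show ?thesis by (simp add: box_gf_def box_points_def)
qed

text \<open>The stretched cell is the disjoint union of \<alpha> translates of the old one by
  multiples of \<open>W j\<close>, so the two sums differ by a geometric sum in
  \<open>fps_exp (pairing (W j) \<zeta>)\<close>. Clearing its denominator gives the
  \<open>exp_quot\<close> factors.\<close>

lemma box_gf_scale_one:
  fixes W :: "'d::finite \<Rightarrow> real ^ 'd"
  assumes W: "indep_family W" and int: "W j \<in> integer_lattice" and \<alpha>: "0 < \<alpha>"
  shows "box_gf p (W(j := real \<alpha> *\<^sub>R W j)) \<zeta> * exp_quot (pairing (W j) \<zeta>) =
         box_gf p W \<zeta> * exp_quot (of_nat \<alpha> * pairing (W j) \<zeta>)"
proof -
  let ?W' = "W(j := real \<alpha> *\<^sub>R W j)" and ?a = "pairing (W j) \<zeta>"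
  let ?f = "\<lambda>(i, n). n + real i *\<^sub>R W j"
  have split: "(\<Sum>k\<in>UNIV. c k *\<^sub>R ?W' k) = (\<Sum>k\<in>UNIV. (c(j := real \<alpha> * c j)) k *\<^sub>R W k)" for c
    by (rule sum.cong) auto
  note add = sum_scaleR_upd_add[symmetric, where W = W]
  have bij: "bij_betw ?f ({..<\<alpha>} \<times> box_points p W) (box_points p ?W')"
    unfolding bij_betw_def
  proof (intro conjI equalityI subsetI)
    show "inj_on ?f ({..<\<alpha>} \<times> box_points p W)"
    proof (rule inj_onI, clarify)
      fix i n i' n' assume n: "n \<in> box_points p W" and n': "n' \<in> box_points p W"
        and eq: "n + real i *\<^sub>R W j = n' + real i' *\<^sub>R W j"
      obtain c where "n \<in> integer_lattice" and
        c: "n = p + (\<Sum>k\<in>UNIV. c k *\<^sub>R W k)" "\<forall>k. 0 \<le> c k" "\<forall>k. c k < 1"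
        using n by (rule box_pointsE) blast
      obtain c' where "n' \<in> integer_lattice" and
        c': "n' = p + (\<Sum>k\<in>UNIV. c' k *\<^sub>R W k)" "\<forall>k. 0 \<le> c' k" "\<forall>k. c' k < 1"
        using n' by (rule box_pointsE) blast
      have "(\<Sum>k\<in>UNIV. (c(j := c j + real i)) k *\<^sub>R W k) =
            (\<Sum>k\<in>UNIV. (c'(j := c' j + real i')) k *\<^sub>R W k)"
        using eq unfolding add[symmetric] c(1) c'(1) by (simp add: add.assoc)
      from indep_family_unique[OF W this, of j] have "c j + real i = c' j + real i'" by simp
      then have "i = i'" using c(2,3)[rule_format, of j] c'(2,3)[rule_format, of j] by linarith
      with eq show "i = i' \<and> n = n'" by simp
    qed
  next
    fix m assume "m \<in> ?f ` ({..<\<alpha>} \<times> box_points p W)"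
    then obtain i n where m: "m = n + real i *\<^sub>R W j" "i < \<alpha>" "n \<in> box_points p W" by auto
    then obtain c where c: "n \<in> integer_lattice" "n = p + (\<Sum>k\<in>UNIV. c k *\<^sub>R W k)"
        "\<forall>k. 0 \<le> c k" "\<forall>k. c k < 1"
      by (elim box_pointsE) blast
    have lt: "c j + real i < real \<alpha>"
      using c(4)[rule_format, of j] m(2) by linarith
    show "m \<in> box_points p ?W'"
    proof (rule box_pointsI[where c = "c(j := (c j + real i) / real \<alpha>)"])
      show "m \<in> integer_lattice"
        using m(1) c(1) int by (simp add: integer_lattice_add integer_lattice_scaleR)
      show "m = p + (\<Sum>k\<in>UNIV. (c(j := (c j + real i) / real \<alpha>)) k *\<^sub>R ?W' k)"
      proof -
        define d where "d = c(j := (c j + real i) / real \<alpha>)"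
        have "d(j := real \<alpha> * d j) = c(j := c j + real i)" using \<alpha> by (simp add: d_def)
        then show ?thesis unfolding d_def[symmetric] split m(1) c(2) add.assoc add by simp
      qed
    qed (use c(3,4) lt \<alpha> in auto)
  next
    fix m assume m: "m \<in> box_points p ?W'"
    obtain c where c: "m \<in> integer_lattice" "m = p + (\<Sum>k\<in>UNIV. c k *\<^sub>R ?W' k)"
        "\<forall>k. 0 \<le> c k" "\<forall>k. c k < 1"
      by (rule box_pointsE[OF m]) (rule that)
    \<comment> \<open>The integer part of the stretched coordinate names the translate that contains
      \<open>m\<close>.\<close>
    define i where "i = nat \<lfloor>real \<alpha> * c j\<rfloor>"
    have nonneg: "0 \<le> real \<alpha> * c j" using c(3) by simp
    have i: "real i \<le> real \<alpha> * c j" "real \<alpha> * c j < real i + 1"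
      using nonneg by (auto simp: i_def)
    have "real \<alpha> * c j < real \<alpha>" using \<alpha> c(4)[rule_format, of j] by simp
    then have "i < \<alpha>" using i by linarith
    moreover have "m - real i *\<^sub>R W j \<in> box_points p W"
    proof (rule box_pointsI[where c = "c(j := real \<alpha> * c j - real i)"])
      show "m - real i *\<^sub>R W j \<in> integer_lattice"
        using c(1) int by (simp add: integer_lattice_diff integer_lattice_scaleR)
      show "m - real i *\<^sub>R W j = p + (\<Sum>k\<in>UNIV. (c(j := real \<alpha> * c j - real i)) k *\<^sub>R W k)"
      proof -
        define d where "d = c(j := real \<alpha> * c j - real i)"
        have "c(j := real \<alpha> * c j) = d(j := d j + real i)" by (simp add: d_def)
        then have "m = p + ((\<Sum>k\<in>UNIV. d k *\<^sub>R W k) + real i *\<^sub>R W j)"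
          unfolding c(2) split add by simp
        then show ?thesis unfolding d_def[symmetric] by simp
      qed
    qed (use c(3,4) i in auto)
    ultimately show "m \<in> ?f ` ({..<\<alpha>} \<times> box_points p W)"
      by (intro image_eqI[where x = "(i, m - real i *\<^sub>R W j)"]) auto
  qed
  have "box_gf p ?W' \<zeta> = (\<Sum>x\<in>{..<\<alpha>} \<times> box_points p W. fps_exp (pairing (?f x) \<zeta>))"
    unfolding box_gf_def by (rule sum.reindex_bij_betw[OF bij, symmetric])
  also have "\<dots> = (\<Sum>i<\<alpha>. \<Sum>n\<in>box_points p W. fps_exp (pairing n \<zeta>) * fps_exp (of_nat i * ?a))"
    by (simp add: sum.cartesian_product pairing_add_left pairing_scaleR_left fps_exp_add_mult split_def)
  also have "\<dots> = box_gf p W \<zeta> * (\<Sum>i<\<alpha>. fps_exp ?a ^ i)"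
    by (simp add: box_gf_def sum_distrib_left sum_distrib_right fps_exp_power_mult)
  finally have "box_gf p ?W' \<zeta> * (fps_exp ?a - 1) =
      box_gf p W \<zeta> * ((fps_exp ?a - 1) * (\<Sum>i<\<alpha>. fps_exp ?a ^ i))"
    by (simp only: mult_ac)
  also have "(fps_exp ?a - 1) * (\<Sum>i<\<alpha>. fps_exp ?a ^ i) = fps_exp ?a ^ \<alpha> - 1"
    using \<alpha> by (simp add: power_diff_1_eq)
  also have "fps_exp ?a ^ \<alpha> = fps_exp (of_nat \<alpha> * ?a)"
    by (rule fps_exp_power_mult)
  finally have "box_gf p ?W' \<zeta> * (fps_X * exp_quot ?a) =
      box_gf p W \<zeta> * (fps_X * exp_quot (of_nat \<alpha> * ?a))"
    by (simp only: fps_X_mult_exp_quot)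
  then have "fps_X * (box_gf p ?W' \<zeta> * exp_quot ?a) =
      fps_X * (box_gf p W \<zeta> * exp_quot (of_nat \<alpha> * ?a))"
    by (simp only: mult.left_commute[of fps_X "box_gf p ?W' \<zeta>"]
        mult.left_commute[of fps_X "box_gf p W \<zeta>"])
  then show ?thesis by simp
qed

lemma box_gf_scale:
  fixes W :: "'d::finite \<Rightarrow> real ^ 'd"
  assumes W: "indep_family W" and int: "\<And>j. W j \<in> integer_lattice"
    and \<alpha>: "\<And>j. 0 < \<alpha> j"
  shows "box_gf p (\<lambda>j. if j \<in> J then real (\<alpha> j) *\<^sub>R W j else W j) \<zeta> *
           (\<Prod>j\<in>J. exp_quot (pairing (W j) \<zeta>)) =
         box_gf p W \<zeta> * (\<Prod>j\<in>J. exp_quot (of_nat (\<alpha> j) * pairing (W j) \<zeta>))"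
proof -
  have "finite J" by simp
  then show ?thesis
  proof induction
    case empty
    then show ?case by simp
  next
    case (insert i J)
    let ?U = "\<lambda>J j. if j \<in> J then real (\<alpha> j) *\<^sub>R W j else W j"
    have "indep_family (\<lambda>j. (if j \<in> J then real (\<alpha> j) else 1) *\<^sub>R W j)"
      using \<alpha> by (intro indep_family_scale W) (simp add: less_imp_neq[symmetric])
    moreover have "(\<lambda>j. (if j \<in> J then real (\<alpha> j) else 1) *\<^sub>R W j) = ?U J" by auto
    ultimately have U: "indep_family (?U J)" by simp
    have upd: "?U (insert i J) = (?U J)(i := real (\<alpha> i) *\<^sub>R ?U J i)"
      using insert.hyps by auto
    have Ui: "?U J i = W i" using insert.hyps by simp
    from box_gf_scale_one[OF U _ \<alpha>[of i], of i p \<zeta>]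
    have "box_gf p (?U (insert i J)) \<zeta> * exp_quot (pairing (W i) \<zeta>) =
          box_gf p (?U J) \<zeta> * exp_quot (of_nat (\<alpha> i) * pairing (W i) \<zeta>)"
      unfolding upd Ui using int by blast
    then have "box_gf p (?U (insert i J)) \<zeta> * exp_quot (pairing (W i) \<zeta>) *
          (\<Prod>j\<in>J. exp_quot (pairing (W j) \<zeta>)) =
        (box_gf p (?U J) \<zeta> * (\<Prod>j\<in>J. exp_quot (pairing (W j) \<zeta>))) *
          exp_quot (of_nat (\<alpha> i) * pairing (W i) \<zeta>)"
      by (simp only: mult_ac)
    then show ?case
      unfolding insert.IH using insert.hyps by (simp add: mult_ac)
  qed
qed

section \<open>Shifts along one generator\<close>

text \<open>The coordinates of both points along \<open>W k\<close> lie in [0,1) and differ by the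
  integer \<open>i\<close>. This makes shifts along \<open>W k\<close> injective on a cell.\<close>

lemma box_points_translate_unique:
  assumes W: "indep_family W" and n: "n \<in> box_points p W" and m: "n + real_of_int i *\<^sub>R W k \<in> box_points p W"
  shows "i = 0"
proof -
  obtain c where "n \<in> integer_lattice" and
    c: "n = p + (\<Sum>k\<in>UNIV. c k *\<^sub>R W k)" "\<forall>k. 0 \<le> c k" "\<forall>k. c k < 1"
    using n by (rule box_pointsE) blast
  obtain c' where "n + real_of_int i *\<^sub>R W k \<in> integer_lattice" and
    c': "n + real_of_int i *\<^sub>R W k = p + (\<Sum>k\<in>UNIV. c' k *\<^sub>R W k)"
      "\<forall>k. 0 \<le> c' k" "\<forall>k. c' k < 1"
    using m by (rule box_pointsE) blast
  have "(\<Sum>k\<in>UNIV. c k *\<^sub>R W k) + real_of_int i *\<^sub>R W k = (\<Sum>l\<in>UNIV. (c(k := c k + i)) l *\<^sub>R W l)"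
    by (rule sum_scaleR_upd_add[symmetric])
  with c c' have "(\<Sum>l\<in>UNIV. (c(k := c k + i)) l *\<^sub>R W l) = (\<Sum>k\<in>UNIV. c' k *\<^sub>R W k)"
    by (simp add: add.assoc)
  from indep_family_unique[OF W this, of k] have "c k + i = c' k" by simp
  then show ?thesis using c(2,3)[rule_format, of k] c'(2,3)[rule_format, of k] by linarith
qed

text \<open>The two frames agree modulo \<open>W k\<close> up to sign there, so all other
  coordinates are kept and only the one along \<open>W k\<close> has to be brought back into [0,1)
  by an integer shift.\<close>

lemma box_points_shift_ex:
  assumes W': "W' k = - W k" and int: "W k \<in> integer_lattice"
    and p': "p' = p + c *\<^sub>R W k" and \<nu>: "\<And>j. j \<noteq> k \<Longrightarrow> W' j = W j + \<nu> j *\<^sub>R W k"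
    and n: "n \<in> box_points p W"
  shows "\<exists>i::int. n + real_of_int i *\<^sub>R W k \<in> box_points p' W'"
proof -
  from n obtain l where l: "n \<in> integer_lattice" "n = p + (\<Sum>k\<in>UNIV. l k *\<^sub>R W k)"
      "\<forall>k. 0 \<le> l k" "\<forall>k. l k < 1"
    by (elim box_pointsE) blast
  \<comment> \<open>\<open>L\<close> is the coordinate of \<open>n\<close> along \<open>W k\<close>
    when the apex is \<open>p'\<close> and the other generators are those of \<open>W'\<close>.
    Along \<open>W' k = - W k\<close> the shifted point has coordinate ceiling of \<open>L\<close>
    minus \<open>L\<close>; the ceiling fits an interval closed at 0.\<close>
  define L where "L = l k - c - (\<Sum>j\<in>UNIV-{k}. l j * \<nu> j)"
  define i where "i = - \<lceil>L\<rceil>"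
  have "n + real_of_int i *\<^sub>R W k \<in> box_points p' W'"
  proof (rule box_pointsI[where c = "l(k := real_of_int \<lceil>L\<rceil> - L)"])
    show "n + real_of_int i *\<^sub>R W k \<in> integer_lattice"
      using l(1) int by (simp add: integer_lattice_add integer_lattice_scaleR)
    have "(\<Sum>j\<in>UNIV. (l(k := real_of_int \<lceil>L\<rceil> - L)) j *\<^sub>R W' j) =
        (L - real_of_int \<lceil>L\<rceil>) *\<^sub>R W k + (\<Sum>j\<in>UNIV-{k}. l j *\<^sub>R W' j)"
      by (subst sum.remove[of UNIV k]) (auto simp: W' scaleR_diff_left)
    also have "(\<Sum>j\<in>UNIV-{k}. l j *\<^sub>R W' j) =
        (\<Sum>j\<in>UNIV-{k}. l j *\<^sub>R W j) + (\<Sum>j\<in>UNIV-{k}. l j * \<nu> j) *\<^sub>R W k"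
      unfolding scaleR_sum_left sum.distrib[symmetric]
      by (rule sum.cong) (auto simp: \<nu> scaleR_add_right)
    also have "(L - real_of_int \<lceil>L\<rceil>) *\<^sub>R W k + \<dots> =
        (\<Sum>j\<in>UNIV. l j *\<^sub>R W j) + (real_of_int i - c) *\<^sub>R W k"
      by (simp add: sum.remove[of UNIV k "\<lambda>j. l j *\<^sub>R W j"] L_def i_def algebra_simps)
    finally show "n + real_of_int i *\<^sub>R W k =
        p' + (\<Sum>j\<in>UNIV. (l(k := real_of_int \<lceil>L\<rceil> - L)) j *\<^sub>R W' j)"
      unfolding p' l(2) by (simp add: algebra_simps)
    show "0 \<le> (l(k := real_of_int \<lceil>L\<rceil> - L)) j" "(l(k := real_of_int \<lceil>L\<rceil> - L)) j < 1" for j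
      using l(3,4)[rule_format, of j] by (auto) linarith+
  qed
  then show ?thesis ..
qed

text \<open>Shifts along \<open>W k\<close> do not change the exponentials, because
  \<open>\<zeta>\<close> pairs to 0 with \<open>W k\<close>, and they match the points of the two
  cells one to one. So the sum sees the cell only modulo \<open>W k\<close>, which is why the
  residues at the two ends of an edge are opposite.\<close>

lemma box_gf_shift:
  fixes W W' :: "'d::finite \<Rightarrow> real ^ 'd"
  assumes W: "indep_family W" and W': "indep_family W'" and int: "W k \<in> integer_lattice"
    and k: "W' k = - W k" and \<zeta>: "pairing (W k) \<zeta> = 0"
    and p': "p' = p + c *\<^sub>R W k" and \<nu>: "\<And>j. j \<noteq> k \<Longrightarrow> W' j = W j + \<nu> j *\<^sub>R W k"
  shows "box_gf p W \<zeta> = box_gf p' W' \<zeta>"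
proof -
  \<comment> \<open>The hypotheses are symmetric in the two frames; their reversed versions serve
    for surjectivity.\<close>
  have k': "W k = - W' k" using k by simp
  have int': "W' k \<in> integer_lattice"
    using integer_lattice_scaleR[OF int, of "-1"] by (simp add: k)
  have p: "p = p' + c *\<^sub>R W' k" by (simp add: p' k)
  have \<nu>': "W j = W' j + \<nu> j *\<^sub>R W' k" if "j \<noteq> k" for j
    using \<nu>[OF that] by (simp add: k)
  obtain h where h: "\<And>n. n \<in> box_points p W \<Longrightarrow> n + real_of_int (h n) *\<^sub>R W k \<in> box_points p' W'"
    using box_points_shift_ex[where W' = W' and \<nu> = \<nu>, OF k int p' \<nu>] by metis
  have bij: "bij_betw (\<lambda>n. n + real_of_int (h n) *\<^sub>R W k) (box_points p W) (box_points p' W')"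
    unfolding bij_betw_def
  proof (intro conjI equalityI subsetI)
    show "inj_on (\<lambda>n. n + real_of_int (h n) *\<^sub>R W k) (box_points p W)"
    proof (rule inj_onI)
      fix n m assume n: "n \<in> box_points p W" and m: "m \<in> box_points p W"
        and eq: "n + real_of_int (h n) *\<^sub>R W k = m + real_of_int (h m) *\<^sub>R W k"
      then have eq': "m = n + real_of_int (h n - h m) *\<^sub>R W k" by (simp add: algebra_simps)
      with box_points_translate_unique[OF W n, of "h n - h m" k] m have "h n - h m = 0" by simp
      with eq' show "n = m" by simp
    qed
  next
    fix m assume "m \<in> (\<lambda>n. n + real_of_int (h n) *\<^sub>R W k) ` box_points p W"
    with h show "m \<in> box_points p' W'" by auto
  next
    fix m assume m: "m \<in> box_points p' W'"
    from box_points_shift_ex[where W' = W and \<nu> = \<nu>, OF k' int' p \<nu>' m] obtain i :: int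
      where i: "m + real_of_int i *\<^sub>R W' k \<in> box_points p W" by blast
    define n where "n = m + real_of_int i *\<^sub>R W' k"
    have n: "n + real_of_int (h n) *\<^sub>R W k = m + real_of_int (i - h n) *\<^sub>R W' k"
      by (simp add: n_def k algebra_simps)
    have "n + real_of_int (h n) *\<^sub>R W k \<in> box_points p' W'"
      using h i unfolding n_def by blast
    then have "m + real_of_int (i - h n) *\<^sub>R W' k \<in> box_points p' W'" by (simp only: n)
    from box_points_translate_unique[OF W' m this] n
    have "m = n + real_of_int (h n) *\<^sub>R W k" by simp
    then show "m \<in> (\<lambda>n. n + real_of_int (h n) *\<^sub>R W k) ` box_points p W"
      using i[folded n_def] by (rule image_eqI)
  qed
  have "box_gf p' W' \<zeta> =
      (\<Sum>n\<in>box_points p W. fps_exp (pairing (n + real_of_int (h n) *\<^sub>R W k) \<zeta>))"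
    unfolding box_gf_def by (rule sum.reindex_bij_betw[OF bij, symmetric])
  also have "\<dots> = box_gf p W \<zeta>"
    by (simp add: box_gf_def pairing_add_left pairing_scaleR_left \<zeta>)
  finally show ?thesis ..
qed

section \<open>Residues along an edge\<close>

text \<open>Some 2 by 2 minor of \<open>a\<close> and \<open>w\<close> is nonzero, and Cramer's rule
  expresses \<mu> through it as a quotient of integers.\<close>

lemma integral_combination_rational:
  fixes a b w :: "real ^ 'd"
  assumes int: "a \<in> integer_lattice" "b \<in> integer_lattice" "w \<in> integer_lattice"
    and eq: "b = \<mu> *\<^sub>R a + \<nu> *\<^sub>R w"
    and indep: "\<And>x y. x *\<^sub>R a + y *\<^sub>R w = 0 \<Longrightarrow> x = 0 \<and> y = 0"
  shows "\<mu> \<in> \<rat>"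
proof -
  have "w \<noteq> 0" using indep[of 0 1] by auto
  then obtain i where i: "w $ i \<noteq> 0" by (auto simp: vec_eq_iff)
  have "w $ i *\<^sub>R a + (- (a $ i)) *\<^sub>R w \<noteq> 0" using indep i by blast
  then obtain l where l: "w $ i * a $ l - a $ i * w $ l \<noteq> 0" by (auto simp: vec_eq_iff)
  have "b $ j = \<mu> * a $ j + \<nu> * w $ j" for j by (simp add: eq)
  then have "w $ i * b $ l - b $ i * w $ l = \<mu> * (w $ i * a $ l - a $ i * w $ l)"
    by (simp add: algebra_simps)
  then have "\<mu> = (w $ i * b $ l - b $ i * w $ l) / (w $ i * a $ l - a $ i * w $ l)"
    using l by (simp add: field_simps)
  moreover have "x $ j \<in> \<rat>" if "x \<in> integer_lattice" for x :: "real ^ 'd" and j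
    using that Ints_subset_Rats by (auto simp: integer_lattice_def)
  ultimately show ?thesis
    using int by simp
qed

lemma indep_family_pair:
  assumes W: "indep_family W" and "j \<noteq> k" and eq: "x *\<^sub>R W j + y *\<^sub>R W k = 0"
  shows "x = 0 \<and> y = 0"
proof -
  define c where "c = (\<lambda>i. (if i = j then x else 0) + (if i = k then y else 0))"
  have "c i *\<^sub>R W i = (if i = j then x *\<^sub>R W j else 0) + (if i = k then y *\<^sub>R W k else 0)" for i
    by (simp add: c_def scaleR_add_left)
  then have "(\<Sum>i\<in>UNIV. c i *\<^sub>R W i) = 0"
    using eq by (simp add: sum.distrib)
  from indep_familyD[OF W this, of j] indep_familyD[OF W this, of k] \<open>j \<noteq> k\<close>
  show ?thesis by (simp add: c_def)
qed

text \<open>After scaling the generators by suitable integers, which multiplies both sides by the same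
  factor, corresponding generators differ by multiples of \<open>W k\<close> only.\<close>
lemma edge_term_eq_aligned:
  fixes W V :: "'d::finite \<Rightarrow> real ^ 'd"
  assumes W: "indep_family W" and V: "indep_family V"
    and intW: "\<And>j. W j \<in> integer_lattice" and intV: "\<And>j. V j \<in> integer_lattice"
    and k: "V k = - W k" and p': "p' = p + c *\<^sub>R W k"
    and proj: "\<And>j. j \<noteq> k \<Longrightarrow> \<exists>\<mu>>0. \<exists>\<nu>. V j = \<mu> *\<^sub>R W j + \<nu> *\<^sub>R W k"
    and \<zeta>: "pairing (W k) \<zeta> = 0" and nz: "\<And>j. j \<noteq> k \<Longrightarrow> pairing (W j) \<zeta> \<noteq> 0"
  shows "box_gf p W \<zeta> * (\<Prod>j\<in>UNIV-{k}. inverse (exp_quot (pairing (W j) \<zeta>))) =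
         box_gf p' V \<zeta> * (\<Prod>j\<in>UNIV-{k}. inverse (exp_quot (pairing (V j) \<zeta>)))"
proof -
  \<comment> \<open>Writing \<mu> as a fraction n / m gives the scalings \<alpha> = m for
    \<open>V j\<close> and \<beta> = n for \<open>W j\<close>.\<close>
  have "\<exists>\<alpha> \<beta> \<mu> \<nu>. 0 < \<alpha> \<and> 0 < \<beta> \<and> 0 < \<mu> \<and> real \<alpha> * \<mu> = real \<beta> \<and> V j = \<mu> *\<^sub>R W j + \<nu> *\<^sub>R W k"
    if j: "j \<noteq> k" for j
  proof -
    from proj[OF j] obtain \<mu> \<nu> where \<mu>: "0 < \<mu>" "V j = \<mu> *\<^sub>R W j + \<nu> *\<^sub>R W k" by blast
    have "\<mu> \<in> \<rat>"
      using integral_combination_rational[OF intW intV intW \<mu>(2)] indep_family_pair[OF W j] by blast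
    then obtain n m where nm: "m > 0" "\<mu> = of_int n / of_int m" by (elim Rats_cases')
    with \<mu>(1) have "0 < n" by (simp add: zero_less_divide_iff)
    with nm \<mu> show ?thesis
      by (intro exI[of _ "nat m"] exI[of _ "nat n"] exI[of _ \<mu>] exI[of _ \<nu>]) auto
  qed
  then obtain \<alpha> \<beta> \<mu> \<nu> where *: "\<And>j. j \<noteq> k \<Longrightarrow> 0 < \<alpha> j \<and> 0 < \<beta> j \<and> 0 < \<mu> j \<and>
      real (\<alpha> j) * \<mu> j = real (\<beta> j) \<and> V j = \<mu> j *\<^sub>R W j + \<nu> j *\<^sub>R W k"
    by metis
  \<comment> \<open>The value 1 at \<open>k\<close> lets one formula also cover the generators with
    label \<open>k\<close>, which stay unscaled.\<close>
  define \<alpha>' where "\<alpha>' = \<alpha>(k := 1)"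
  define \<beta>' where "\<beta>' = \<beta>(k := 1)"
  have pos: "0 < \<alpha>' j" "0 < \<beta>' j" for j using * by (auto simp: \<alpha>'_def \<beta>'_def)
  let ?U = "\<lambda>j. if j \<in> UNIV - {k} then real (\<beta>' j) *\<^sub>R W j else W j"
  let ?U' = "\<lambda>j. if j \<in> UNIV - {k} then real (\<alpha>' j) *\<^sub>R V j else V j"
  have eqU: "?U = (\<lambda>j. real (\<beta>' j) *\<^sub>R W j)" "?U' = (\<lambda>j. real (\<alpha>' j) *\<^sub>R V j)"
    by (auto simp: \<alpha>'_def \<beta>'_def)
  have U: "indep_family ?U" "indep_family ?U'"
    unfolding eqU using pos by (auto intro!: indep_family_scale W V simp: less_imp_neq[symmetric])
  have rel: "?U' j = ?U j + (real (\<alpha>' j) * \<nu> j) *\<^sub>R ?U k" if "j \<noteq> k" for j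
    using *[OF that] that by (simp add: \<alpha>'_def \<beta>'_def scaleR_add_right)
  have G: "box_gf p ?U \<zeta> = box_gf p' ?U' \<zeta>"
    by (rule box_gf_shift[where k = k and c = c and \<nu> = "\<lambda>j. real (\<alpha>' j) * \<nu> j"])
      (use U rel in \<open>simp_all add: intW k \<zeta> p'\<close>)
  let ?X = "\<Prod>j\<in>UNIV-{k}. exp_quot (pairing (W j) \<zeta>)"
  let ?Y = "\<Prod>j\<in>UNIV-{k}. exp_quot (pairing (V j) \<zeta>)"
  let ?Z = "\<Prod>j\<in>UNIV-{k}. exp_quot (of_nat (\<beta>' j) * pairing (W j) \<zeta>)"
  \<comment> \<open>\<open>\<zeta>\<close> annihilates the part along \<open>W k\<close>, so the
    scaled pairings coincide and both scaling identities below contain the same factor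
    \<open>?Z\<close>.\<close>
  have pV: "of_nat (\<alpha>' j) * pairing (V j) \<zeta> = of_nat (\<beta>' j) * pairing (W j) \<zeta>"
      "pairing (V j) \<zeta> \<noteq> 0" if "j \<noteq> k" for j
  proof -
    have \<mu>0: "0 < \<mu> j" using *[OF that] by blast
    have V': "pairing (V j) \<zeta> = of_real (\<mu> j) * pairing (W j) \<zeta>"
      using *[OF that] by (simp add: pairing_add_left pairing_scaleR_left \<zeta>)
    have "of_nat (\<alpha> j) * of_real (\<mu> j) = (of_nat (\<beta> j) :: complex)"
      using *[OF that] by (metis of_real_mult of_real_of_nat_eq)
    then show "of_nat (\<alpha>' j) * pairing (V j) \<zeta> = of_nat (\<beta>' j) * pairing (W j) \<zeta>"
      using that by (simp add: V' \<alpha>'_def \<beta>'_def flip: mult.assoc)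
    show "pairing (V j) \<zeta> \<noteq> 0"
      using \<mu>0 nz[OF that] unfolding V' by simp
  qed
  have Z': "(\<Prod>j\<in>UNIV-{k}. exp_quot (of_nat (\<alpha>' j) * pairing (V j) \<zeta>)) = ?Z"
    by (rule prod.cong) (simp_all add: pV)
  have 1: "box_gf p ?U \<zeta> * ?X = box_gf p W \<zeta> * ?Z"
    by (rule box_gf_scale[OF W intW pos(2)])
  have 2: "box_gf p ?U \<zeta> * ?Y = box_gf p' V \<zeta> * ?Z"
    unfolding G Z'[symmetric] by (rule box_gf_scale[OF V intV pos(1)])
  have ne: "exp_quot a \<noteq> 0" "exp_quot a * inverse (exp_quot a) = 1" if "a \<noteq> 0" for a
  proof -
    have "fps_nth (exp_quot a) 0 \<noteq> 0" using that by (simp add: exp_quot_nth)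
    then show "exp_quot a \<noteq> 0" "exp_quot a * inverse (exp_quot a) = 1"
      by (auto intro: inverse_mult_eq_1')
  qed
  have Z: "?Z \<noteq> 0"
    using nz pos by (simp add: ne(1) less_imp_neq[symmetric])
  have inv: "?X * (\<Prod>j\<in>UNIV-{k}. inverse (exp_quot (pairing (W j) \<zeta>))) = 1"
      "?Y * (\<Prod>j\<in>UNIV-{k}. inverse (exp_quot (pairing (V j) \<zeta>))) = 1"
    unfolding prod.distrib[symmetric] using nz pV by (auto intro!: prod.neutral ne(2))
  let ?IX = "\<Prod>j\<in>UNIV-{k}. inverse (exp_quot (pairing (W j) \<zeta>))"
  let ?IY = "\<Prod>j\<in>UNIV-{k}. inverse (exp_quot (pairing (V j) \<zeta>))"
  have "?Z * (box_gf p W \<zeta> * ?IX) = (box_gf p W \<zeta> * ?Z) * ?IX" by (simp only: mult_ac)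
  also have "\<dots> = box_gf p ?U \<zeta> * (?X * ?IX)" unfolding 1[symmetric] by (simp only: mult_ac)
  also have "\<dots> = box_gf p ?U \<zeta> * (?Y * ?IY)" unfolding inv ..
  also have "\<dots> = (box_gf p' V \<zeta> * ?Z) * ?IY" unfolding 2[symmetric] by (simp only: mult_ac)
  also have "\<dots> = ?Z * (box_gf p' V \<zeta> * ?IY)" by (simp only: mult_ac)
  finally show ?thesis using Z by simp
qed

text \<open>\<open>\<sigma>\<close> matches the edges at the two ends. Neither the cell nor the
  product of inverses depends on the labelling, so relabelling \<open>V\<close> by
  \<open>\<sigma>\<close> reduces to the aligned case.\<close>

lemma edge_term_eq:
  fixes W V :: "'d::finite \<Rightarrow> real ^ 'd"
  assumes W: "indep_family W" and V: "indep_family V"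
    and intW: "\<And>j. W j \<in> integer_lattice" and intV: "\<And>j. V j \<in> integer_lattice"
    and \<sigma>: "bij \<sigma>" and k: "V (\<sigma> k) = - W k" and p': "p' = p + c *\<^sub>R W k"
    and proj: "\<And>j. j \<noteq> k \<Longrightarrow> \<exists>\<mu>>0. \<exists>\<nu>. V (\<sigma> j) = \<mu> *\<^sub>R W j + \<nu> *\<^sub>R W k"
    and \<zeta>: "pairing (W k) \<zeta> = 0" and nz: "\<And>j. j \<noteq> k \<Longrightarrow> pairing (W j) \<zeta> \<noteq> 0"
  shows "box_gf p W \<zeta> * (\<Prod>j\<in>UNIV-{k}. inverse (exp_quot (pairing (W j) \<zeta>))) =
         box_gf p' V \<zeta> * (\<Prod>j\<in>UNIV-{\<sigma> k}. inverse (exp_quot (pairing (V j) \<zeta>)))"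
proof -
  have "bij_betw \<sigma> (UNIV - {k}) (UNIV - {\<sigma> k})"
    using \<sigma>
    by (intro bij_betw_subset[OF \<sigma>]) (simp_all add: image_set_diff bij_is_inj bij_is_surj)
  from prod.reindex_bij_betw[OF this, of "\<lambda>j. inverse (exp_quot (pairing (V j) \<zeta>))"]
  show ?thesis
    using edge_term_eq_aligned[OF W indep_family_reindex[OF V \<sigma>] intW, of k p' p c \<zeta>]
    by (simp add: intV k p' proj \<zeta> nz box_gf_reindex[OF \<sigma>])
qed

section \<open>Partial fractions along a generic line\<close>

text \<open>Lagrange interpolation of \<open>p\<close> at the zeros of the linear factors
  \<open>a k + s * b k\<close>, evaluated at \<open>s = 0\<close> and divided by the product of the
  \<open>a k\<close>. The zeros are distinct by \<open>ab\<close>, and the degree bound makes the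
  interpolation exact.\<close>

lemma partial_fractions_at_0:
  fixes a b :: "'k::finite \<Rightarrow> complex" and p :: "complex poly"
  assumes deg: "degree p < CARD('k)"
    and a: "\<And>k. a k \<noteq> 0" and b: "\<And>k. b k \<noteq> 0"
    and ab: "\<And>j k. j \<noteq> k \<Longrightarrow> a j * b k \<noteq> a k * b j"
  shows "poly p 0 / (\<Prod>k\<in>UNIV. a k) =
    (\<Sum>k\<in>UNIV. poly p (- (a k / b k)) / (a k * (\<Prod>j\<in>UNIV-{k}. a j + - (a k / b k) * b j)))"
proof -
  define s where "s k = - (a k / b k)" for k
  define L where "L k = (\<Prod>j\<in>UNIV-{k}. [:a j, b j:])" for k
  have polyL: "poly (L k) x = (\<Prod>j\<in>UNIV-{k}. a j + x * b j)" for k x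
    by (simp add: L_def poly_prod)
  have s0: "a k + s k * b k = 0" for k using b by (simp add: s_def)
  have s1: "a j + s k * b j \<noteq> 0" if "j \<noteq> k" for j k
    using ab[OF that] b[of k] by (simp add: s_def field_simps)
  have L0: "poly (L k) (s i) = 0" if "i \<noteq> k" for i k
    unfolding polyL by (rule prod_zero) (use that s0 in auto)
  have L1: "poly (L k) (s k) \<noteq> 0" for k
    unfolding polyL using s1 by (simp add: prod_zero_iff)
  have inj: "inj s"
  proof (rule injI, rule ccontr)
    fix x y assume "s x = s y" "x \<noteq> y"
    with s0[of x] s1[of x y] show False by simp
  qed
  define q where "q = (\<Sum>k\<in>UNIV. smult (poly p (s k) / poly (L k) (s k)) (L k))"
  have degL: "degree (L k) \<le> CARD('k) - 1" for k
  proof -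
    have "degree (L k) \<le> (\<Sum>j\<in>UNIV-{k}. degree [:a j, b j:])"
      unfolding L_def using degree_prod_sum_le[of "UNIV-{k}" "\<lambda>j. [:a j, b j:]"] by (simp add: o_def)
    also have "\<dots> \<le> (\<Sum>j\<in>UNIV-{k}. 1)" by (intro sum_mono) auto
    finally show ?thesis by simp
  qed
  have "p = q"
  proof (rule poly_eqI_degree[where A = "range s"])
    fix x assume "x \<in> range s"
    then obtain i where x: "x = s i" by auto
    have "poly q x = (\<Sum>k\<in>UNIV. if k = i then poly p x else 0)"
      unfolding q_def poly_sum by (rule sum.cong) (auto simp: x L0 L1)
    then show "poly p x = poly q x" by simp
  next
    show "degree p < card (range s)" using deg by (simp add: card_image inj)
    have "degree q \<le> CARD('k) - 1"
      unfolding q_def by (intro degree_sum_le order_trans[OF degree_smult_le degL]) simp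
    moreover have "card (range s) = CARD('k)" by (simp add: card_image inj)
    ultimately show "degree q < card (range s)" using deg by linarith
  qed
  then have "poly p 0 = poly q 0" by (rule arg_cong)
  also have "\<dots> = (\<Sum>k\<in>UNIV. poly p (s k) / poly (L k) (s k) * poly (L k) 0)"
    by (simp add: q_def poly_sum)
  finally have "poly p 0 / (\<Prod>k\<in>UNIV. a k) =
      (\<Sum>k\<in>UNIV. poly p (s k) / poly (L k) (s k) * poly (L k) 0 / (\<Prod>k\<in>UNIV. a k))"
    by (simp add: sum_divide_distrib)
  also have "\<dots> = (\<Sum>k\<in>UNIV. poly p (s k) / (a k * poly (L k) (s k)))"
  proof (rule sum.cong)
    fix k
    have "(\<Prod>k\<in>UNIV. a k) = a k * poly (L k) 0"
      by (simp add: polyL prod.remove[of UNIV k])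
    moreover have "poly (L k) 0 \<noteq> 0" by (simp add: polyL a)
    ultimately show "poly p (s k) / poly (L k) (s k) * poly (L k) 0 / (\<Prod>k\<in>UNIV. a k) =
        poly p (s k) / (a k * poly (L k) (s k))"
      by simp
  qed simp
  finally show ?thesis by (simp add: polyL s_def)
qed

text \<open>Homogeneity in \<open>z\<close>, restricted to a line with parameter \<open>s\<close>.\<close>
definition graded_family :: "(complex \<Rightarrow> complex fps) \<Rightarrow> bool" where
  "graded_family F \<longleftrightarrow> (\<forall>n. \<exists>p. degree p \<le> n \<and> (\<forall>s. fps_nth (F s) n = poly p s))"

lemma graded_family_linear:
  assumes "\<And>s n. fps_nth (F s) n = (a + s * b) ^ n * c n"
  shows "graded_family F"
  unfolding graded_family_def
proof
  fix n
  have "degree (smult (c n) ([:a, b:] ^ n)) \<le> n"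
    using degree_power_le[of "[:a, b:]" n] by (auto intro: order_trans[OF degree_smult_le] order_trans)
  moreover have "fps_nth (F s) n = poly (smult (c n) ([:a, b:] ^ n)) s" for s
    by (simp add: assms poly_power)
  ultimately show "\<exists>p. degree p \<le> n \<and> (\<forall>s. fps_nth (F s) n = poly p s)" by blast
qed

lemma graded_family_mult:
  assumes "graded_family F" "graded_family G"
  shows "graded_family (\<lambda>s. F s * G s)"
proof -
  from assms obtain p q where p: "\<And>n. degree (p n) \<le> n" "\<And>n s. fps_nth (F s) n = poly (p n) s"
    and q: "\<And>n. degree (q n) \<le> n" "\<And>n s. fps_nth (G s) n = poly (q n) s"
    unfolding graded_family_def by metis
  have "degree (\<Sum>i=0..n. p i * q (n - i)) \<le> n" for n
  proof (rule degree_sum_le)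
    fix i assume "i \<in> {0..n}"
    then show "degree (p i * q (n - i)) \<le> n"
      using degree_mult_le[of "p i" "q (n - i)"] p(1)[of i] q(1)[of "n - i"] by simp
  qed simp
  moreover have "fps_nth (F s * G s) n = poly (\<Sum>i=0..n. p i * q (n - i)) s" for s n
    by (simp add: fps_mult_nth poly_sum p(2) q(2))
  ultimately show ?thesis unfolding graded_family_def by blast
qed

lemma graded_family_1: "graded_family (\<lambda>s. 1)"
  by (rule graded_family_linear[where a = 0 and b = 0 and c = "\<lambda>_. 1"]) simp

lemma graded_family_prod:
  assumes "\<And>j. j \<in> A \<Longrightarrow> graded_family (F j)"
  shows "graded_family (\<lambda>s. \<Prod>j\<in>A. F j s)"
  using assms
  by (induction A rule: infinite_finite_induct) (simp_all add: graded_family_mult graded_family_1)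

lemma graded_family_sum:
  assumes "\<And>j. j \<in> A \<Longrightarrow> graded_family (F j)"
  shows "graded_family (\<lambda>s. \<Sum>j\<in>A. F j s)"
  unfolding graded_family_def
proof
  fix n
  have "\<exists>p. \<forall>j\<in>A. degree (p j) \<le> n \<and> (\<forall>s. fps_nth (F j s) n = poly (p j) s)"
    using assms unfolding graded_family_def by (intro bchoice) blast
  then obtain p where p: "\<And>j. j \<in> A \<Longrightarrow> degree (p j) \<le> n"
      "\<And>j s. j \<in> A \<Longrightarrow> fps_nth (F j s) n = poly (p j) s"
    by blast
  have "degree (\<Sum>j\<in>A. p j) \<le> n"
    by (cases "finite A") (simp_all add: degree_sum_le p)
  moreover have "fps_nth (\<Sum>j\<in>A. F j s) n = poly (\<Sum>j\<in>A. p j) s" for s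
    by (simp add: fps_sum_nth poly_sum p)
  ultimately show "\<exists>p. degree p \<le> n \<and> (\<forall>s. fps_nth (\<Sum>j\<in>A. F j s) n = poly p s)" by blast
qed

text \<open>\<open>\<zeta> k\<close> is the point of the line \<open>z + s *s y\<close> on the
  hyperplane orthogonal to \<open>W k\<close>. Multiplying by the linear factors turns each inverse
  into a Todd series, so the numerator is a polynomial in s of degree at most \<open>m\<close>; the
  summands are its partial fractions at \<open>s = 0\<close>.\<close>

lemma vertex_term_partial_fractions:
  fixes W :: "'d::finite \<Rightarrow> real ^ 'd" and z y :: "complex ^ 'd"
  assumes m: "m < CARD('d)"
    and a: "\<And>k. pairing (W k) z \<noteq> 0" and b: "\<And>k. pairing (W k) y \<noteq> 0"
    and ab: "\<And>j k. j \<noteq> k \<Longrightarrow>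
      pairing (W j) z * pairing (W k) y \<noteq> pairing (W k) z * pairing (W j) y"
  defines "\<zeta> \<equiv> \<lambda>k. z + - (pairing (W k) z / pairing (W k) y) *s y"
  shows "fps_nth (box_gf p W z * (\<Prod>k\<in>UNIV. inverse (exp_quot (pairing (W k) z)))) m =
    (\<Sum>k\<in>UNIV. fps_nth (box_gf p W (\<zeta> k) *
        (\<Prod>j\<in>UNIV-{k}. inverse (exp_quot (pairing (W j) (\<zeta> k))))) m / pairing (W k) z)"
proof -
  have \<zeta>_fold: "z + - (pairing (W k) z / pairing (W k) y) *s y = \<zeta> k" for k
    by (simp only: \<zeta>_def)
  \<comment> \<open>\<open>F\<close> is the numerator; in terms of Todd series it also makes sense
    at the poles.\<close>
  define F where "F s = box_gf p W (z + s *s y) * (\<Prod>j\<in>UNIV. todd_series (pairing (W j) (z + s *s y)))"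
    for s
  have "graded_family F"
    unfolding F_def box_gf_def
  proof (intro graded_family_mult graded_family_sum graded_family_prod)
    fix n :: "real ^ 'd"
    show "graded_family (\<lambda>s. fps_exp (pairing n (z + s *s y)))"
      by (rule graded_family_linear[where a = "pairing n z" and b = "pairing n y" and c = "\<lambda>n. 1 / fact n"])
        (simp add: pairing_add_smult_right)
  next
    fix j
    show "graded_family (\<lambda>s. todd_series (pairing (W j) (z + s *s y)))"
      by (rule graded_family_linear[where a = "pairing (W j) z" and b = "pairing (W j) y"
            and c = "fps_nth (inverse (exp_quot 1))"])
        (simp add: pairing_add_smult_right todd_series_def)
  qed
  then obtain P where P: "degree P \<le> m" "\<And>s. fps_nth (F s) m = poly P s"
    unfolding graded_family_def by blast
  have const: "(\<Prod>j\<in>A. fps_const (f j)) = fps_const (\<Prod>j\<in>A. f j)" for A and f :: "'d \<Rightarrow> complex"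
    by (induction A rule: infinite_finite_induct) simp_all
  have F0: "poly P 0 = (\<Prod>k\<in>UNIV. pairing (W k) z) *
      fps_nth (box_gf p W z * (\<Prod>k\<in>UNIV. inverse (exp_quot (pairing (W k) z)))) m"
  proof -
    have "F 0 = fps_const (\<Prod>k\<in>UNIV. pairing (W k) z) *
        (box_gf p W z * (\<Prod>k\<in>UNIV. inverse (exp_quot (pairing (W k) z))))"
      by (simp add: F_def todd_series_eq a prod.distrib const mult_ac)
    then show ?thesis by (simp add: P(2)[symmetric])
  qed
  \<comment> \<open>At its own pole the k-th Todd series is 1, so the factor of \<open>W k\<close>
    disappears; the other pairings are nonzero there and can be split off again.\<close>
  have Fk: "poly P (- (pairing (W k) z / pairing (W k) y)) =
      (\<Prod>j\<in>UNIV-{k}. pairing (W j) (\<zeta> k)) *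
      fps_nth (box_gf p W (\<zeta> k) * (\<Prod>j\<in>UNIV-{k}. inverse (exp_quot (pairing (W j) (\<zeta> k))))) m"
    and nz: "(\<Prod>j\<in>UNIV-{k}. pairing (W j) (\<zeta> k)) \<noteq> 0" for k
  proof -
    have 0: "pairing (W k) (\<zeta> k) = 0"
      unfolding \<zeta>_def pairing_add_smult_right using b by simp
    have 1: "pairing (W j) (\<zeta> k) \<noteq> 0" if "j \<noteq> k" for j
      using ab[OF that] b[of k] unfolding \<zeta>_def pairing_add_smult_right
      by (simp add: field_simps)
    then show "(\<Prod>j\<in>UNIV-{k}. pairing (W j) (\<zeta> k)) \<noteq> 0" by simp
    have "(\<Prod>j\<in>UNIV. todd_series (pairing (W j) (\<zeta> k))) =
        (\<Prod>j\<in>UNIV-{k}. todd_series (pairing (W j) (\<zeta> k)))"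
      by (simp add: prod.remove[of UNIV k] 0 todd_series_0)
    also have "\<dots> = (\<Prod>j\<in>UNIV-{k}. fps_const (pairing (W j) (\<zeta> k)) *
        inverse (exp_quot (pairing (W j) (\<zeta> k))))"
      by (rule prod.cong) (use 1 in \<open>auto simp: todd_series_eq\<close>)
    finally have "F (- (pairing (W k) z / pairing (W k) y)) =
        fps_const (\<Prod>j\<in>UNIV-{k}. pairing (W j) (\<zeta> k)) *
        (box_gf p W (\<zeta> k) * (\<Prod>j\<in>UNIV-{k}. inverse (exp_quot (pairing (W j) (\<zeta> k)))))"
      unfolding F_def \<zeta>_fold by (simp only: prod.distrib const mult_ac)
    then show "poly P (- (pairing (W k) z / pairing (W k) y)) =
      (\<Prod>j\<in>UNIV-{k}. pairing (W j) (\<zeta> k)) *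
      fps_nth (box_gf p W (\<zeta> k) * (\<Prod>j\<in>UNIV-{k}. inverse (exp_quot (pairing (W j) (\<zeta> k))))) m"
      by (simp add: P(2)[symmetric])
  qed
  have den: "(\<Prod>j\<in>UNIV-{k}. pairing (W j) z + - (pairing (W k) z / pairing (W k) y) * pairing (W j) y)
      = (\<Prod>j\<in>UNIV-{k}. pairing (W j) (\<zeta> k))" for k
    unfolding \<zeta>_def pairing_add_smult_right ..
  have "poly P 0 / (\<Prod>k\<in>UNIV. pairing (W k) z) =
    (\<Sum>k\<in>UNIV. poly P (- (pairing (W k) z / pairing (W k) y)) /
      (pairing (W k) z * (\<Prod>j\<in>UNIV-{k}. pairing (W j) (\<zeta> k))))"
    unfolding den[symmetric]
    by (rule partial_fractions_at_0) (use P(1) m a b ab in auto)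
  also have "poly P 0 / (\<Prod>k\<in>UNIV. pairing (W k) z) =
      fps_nth (box_gf p W z * (\<Prod>k\<in>UNIV. inverse (exp_quot (pairing (W k) z)))) m"
    using a by (simp add: F0)
  also have "(\<Sum>k\<in>UNIV. poly P (- (pairing (W k) z / pairing (W k) y)) /
      (pairing (W k) z * (\<Prod>j\<in>UNIV-{k}. pairing (W j) (\<zeta> k)))) =
    (\<Sum>k\<in>UNIV. fps_nth (box_gf p W (\<zeta> k) *
        (\<Prod>j\<in>UNIV-{k}. inverse (exp_quot (pairing (W j) (\<zeta> k))))) m / pairing (W k) z)"
    by (rule sum.cong) (use nz in \<open>simp_all add: Fk\<close>)
  finally show ?thesis .
qed

text \<open>A point of the moment curve avoids finitely many hyperplanes.\<close>
lemma ex_avoiding_hyperplanes: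
  fixes C :: "(complex ^ 'd::finite) set"
  assumes "finite C" "0 \<notin> C"
  shows "\<exists>y :: complex ^ 'd. \<forall>c\<in>C. (\<Sum>i\<in>UNIV. c $ i * y $ i) \<noteq> 0"
proof -
  obtain f :: "'d \<Rightarrow> nat" where f: "inj f"
    using finite_imp_inj_to_nat_seg[of "UNIV :: 'd set"] by auto
  \<comment> \<open>\<open>q c\<close> is the linear form \<open>c\<close> along the curve with
    coordinates \<open>s ^ f i\<close>; injectivity of \<open>f\<close> keeps its coefficients
    apart.\<close>
  define q where "q c = (\<Sum>i\<in>UNIV. monom (c $ i) (f i))" for c :: "complex ^ 'd"
  have "q c \<noteq> 0" if "c \<noteq> 0" for c
  proof -
    obtain i where i: "c $ i \<noteq> 0" using \<open>c \<noteq> 0\<close> by (auto simp: vec_eq_iff)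
    have "poly.coeff (q c) (f i) = (\<Sum>j\<in>UNIV. if j = i then c $ i else 0)"
      unfolding q_def coeff_sum by (rule sum.cong) (use f in \<open>auto simp: inj_eq\<close>)
    then show ?thesis using i by auto
  qed
  then have "(\<Prod>c\<in>C. q c) \<noteq> 0"
    using assms by (simp add: prod_zero_iff) metis
  then have "finite {s. poly (\<Prod>c\<in>C. q c) s = 0}" by (rule poly_roots_finite)
  then obtain s where "poly (\<Prod>c\<in>C. q c) s \<noteq> 0"
    using ex_new_if_finite[OF infinite_UNIV_char_0] by auto
  then have s: "\<forall>c\<in>C. poly (q c) s \<noteq> 0"
    using assms(1) by (simp add: poly_prod prod_zero_iff)
  have "poly (q c) s = (\<Sum>i\<in>UNIV. c $ i * (\<chi> i. s ^ f i) $ i)" for c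
    by (simp add: q_def poly_sum poly_monom)
  with s show ?thesis by (intro exI[of _ "\<chi> i. s ^ f i"]) simp
qed

text \<open>The real and imaginary parts of a complex relation would be real relations between
  \<open>W k\<close> and \<open>W j\<close>.\<close>

lemma indep_family_complex_pair:
  fixes W :: "'d::finite \<Rightarrow> real ^ 'd"
  assumes W: "indep_family W" and "j \<noteq> k" and "(a::complex) \<noteq> 0"
  shows "(\<chi> i. a * of_real (W k $ i) - b * of_real (W j $ i)) \<noteq> 0"
proof
  assume "(\<chi> i. a * of_real (W k $ i) - b * of_real (W j $ i)) = 0"
  then have eq: "a * of_real (W k $ i) - b * of_real (W j $ i) = 0" for i
    by (simp add: vec_eq_iff)
  have "Re a *\<^sub>R W k + (- Re b) *\<^sub>R W j = 0" "Im a *\<^sub>R W k + (- Im b) *\<^sub>R W j = 0"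
    using arg_cong[OF eq, of Re] arg_cong[OF eq, of Im] by (simp_all add: vec_eq_iff)
  then have "Re a = 0" "Im a = 0"
    using indep_family_pair[OF W, of k j] \<open>j \<noteq> k\<close> by blast+
  with \<open>a \<noteq> 0\<close> show False by (simp add: complex_eq_iff)
qed

text \<open>Avoiding the hyperplanes from \<open>C1\<close> makes the line through \<open>z\<close>
  in direction \<open>y\<close> meet each hyperplane orthogonal to a generator; avoiding those from
  \<open>C2\<close> separates the meeting points of distinct generators at one vertex, so the poles
  are simple.\<close>

lemma ex_generic_direction:
  fixes W :: "'v \<Rightarrow> 'd::finite \<Rightarrow> real ^ 'd"
  assumes V: "finite V" and W: "\<And>v. v \<in> V \<Longrightarrow> indep_family (W v)"
    and a: "\<And>v k. v \<in> V \<Longrightarrow> pairing (W v k) z \<noteq> 0"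
  obtains y :: "complex ^ 'd" where
    "\<And>v k. v \<in> V \<Longrightarrow> pairing (W v k) y \<noteq> 0"
    "\<And>v j k. v \<in> V \<Longrightarrow> j \<noteq> k \<Longrightarrow>
      pairing (W v j) z * pairing (W v k) y \<noteq> pairing (W v k) z * pairing (W v j) y"
proof -
  define C1 :: "(complex ^ 'd) set" where "C1 = (\<lambda>(v, k). \<chi> i. of_real (W v k $ i)) ` (V \<times> UNIV)"
  define C2 :: "(complex ^ 'd) set" where "C2 =
    (\<lambda>(v, j, k). \<chi> i. pairing (W v j) z * of_real (W v k $ i) - pairing (W v k) z * of_real (W v j $ i)) `
      (V \<times> {(j, k). j \<noteq> k})"
  have "finite (C1 \<union> C2)" using V by (simp add: C1_def C2_def)
  moreover have "0 \<notin> C1 \<union> C2"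
  proof -
    have "(\<chi> i. of_real (W v k $ i)) \<noteq> (0 :: complex ^ 'd)" if "v \<in> V" for v k
    proof
      assume "(\<chi> i. of_real (W v k $ i)) = (0 :: complex ^ 'd)"
      then have "W v k = 0" by (simp add: vec_eq_iff)
      with a[OF that, of k] show False by (simp add: pairing_def)
    qed
    moreover have "(\<chi> i. pairing (W v j) z * of_real (W v k $ i) -
        pairing (W v k) z * of_real (W v j $ i)) \<noteq> 0" if "v \<in> V" "j \<noteq> k" for v j k
      using indep_family_complex_pair[OF W[OF that(1)] that(2) a[OF that(1)]] .
    ultimately show ?thesis by (fastforce simp: C1_def C2_def)
  qed
  ultimately obtain y :: "complex ^ 'd" where y: "\<forall>c\<in>C1 \<union> C2. (\<Sum>i\<in>UNIV. c $ i * y $ i) \<noteq> 0"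
    using ex_avoiding_hyperplanes by blast
  show ?thesis
  proof
    fix v k assume "v \<in> V"
    then have "(\<chi> i. of_real (W v k $ i)) \<in> C1 \<union> C2" unfolding C1_def by force
    from y[rule_format, OF this] show "pairing (W v k) y \<noteq> 0" by (simp add: pairing_def)
  next
    fix v j k assume v: "v \<in> V" "j \<noteq> (k::'d)"
    then have "(\<chi> i. pairing (W v j) z * of_real (W v k $ i) - pairing (W v k) z * of_real (W v j $ i))
        \<in> C1 \<union> C2" unfolding C2_def by force
    from y[rule_format, OF this]
    have "pairing (W v j) z * pairing (W v k) y - pairing (W v k) z * pairing (W v j) y \<noteq> 0"
      by (simp add: pairing_def sum_distrib_left sum_subtractf left_diff_distrib mult.assoc)
    then show "pairing (W v j) z * pairing (W v k) y \<noteq> pairing (W v k) z * pairing (W v j) y" by simp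
  qed
qed

text \<open>Splitting each vertex term into partial fractions along a generic line attaches one summand
  to each flag of a vertex and an edge; the two flags of an edge cancel.\<close>
lemma sum_vertex_terms_eq_0:
  fixes V :: "(real ^ 'd) set" and W :: "real ^ 'd \<Rightarrow> 'd::finite \<Rightarrow> real ^ 'd"
    and \<epsilon> :: "real ^ 'd \<Rightarrow> 'd \<Rightarrow> 'e"
  assumes V: "finite V" and m: "m < CARD('d)"
    and W: "\<And>v. v \<in> V \<Longrightarrow> indep_family (W v)"
    and int: "\<And>v k. v \<in> V \<Longrightarrow> W v k \<in> integer_lattice"
    and a: "\<And>v k. v \<in> V \<Longrightarrow> pairing (W v k) z \<noteq> 0"
    and \<epsilon>: "\<And>v. v \<in> V \<Longrightarrow> bij_betw (\<epsilon> v) UNIV (Ed v)"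
    and ends: "\<And>v e. v \<in> V \<Longrightarrow> e \<in> Ed v \<Longrightarrow> \<exists>u. u \<noteq> v \<and> {x\<in>V. e \<in> Ed x} = {u, v}"
    and edge: "\<And>u v k k'. u \<in> V \<Longrightarrow> v \<in> V \<Longrightarrow> u \<noteq> v \<Longrightarrow> \<epsilon> u k = \<epsilon> v k' \<Longrightarrow>
      W v k' = - W u k \<and> (\<exists>c. v = u + c *\<^sub>R W u k) \<and>
      (\<exists>\<sigma>. bij \<sigma> \<and> \<sigma> k = k' \<and> (\<forall>j. j \<noteq> k \<longrightarrow> (\<exists>\<mu>>0. \<exists>\<nu>. W v (\<sigma> j) = \<mu> *\<^sub>R W u j + \<nu> *\<^sub>R W u k)))"
  shows "(\<Sum>v\<in>V. fps_nth (box_gf (t *\<^sub>R v) (W v) z *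
    (\<Prod>k\<in>UNIV. inverse (exp_quot (pairing (W v k) z)))) m) = 0"
proof -
  obtain y :: "complex ^ 'd" where b: "\<And>v k. v \<in> V \<Longrightarrow> pairing (W v k) y \<noteq> 0"
    and ab: "\<And>v j k. v \<in> V \<Longrightarrow> j \<noteq> k \<Longrightarrow>
      pairing (W v j) z * pairing (W v k) y \<noteq> pairing (W v k) z * pairing (W v j) y"
    using ex_generic_direction[of V W z] V W a by blast
  define \<zeta> where "\<zeta> v k = z + - (pairing (W v k) z / pairing (W v k) y) *s y" for v k
  define R where "R v k = fps_nth (box_gf (t *\<^sub>R v) (W v) (\<zeta> v k) *
        (\<Prod>j\<in>UNIV-{k}. inverse (exp_quot (pairing (W v j) (\<zeta> v k))))) m / pairing (W v k) z" for v k
  \<comment> \<open>Residues are indexed by the edge itself, since labels at different vertices are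
    unrelated.\<close>
  define g where "g v e = R v (inv_into UNIV (\<epsilon> v) e)" for v e
  have flags: "fps_nth (box_gf (t *\<^sub>R v) (W v) z *
      (\<Prod>k\<in>UNIV. inverse (exp_quot (pairing (W v k) z)))) m = (\<Sum>e\<in>Ed v. g v e)" if v: "v \<in> V" for v
  proof -
    have "fps_nth (box_gf (t *\<^sub>R v) (W v) z *
      (\<Prod>k\<in>UNIV. inverse (exp_quot (pairing (W v k) z)))) m = (\<Sum>k\<in>UNIV. R v k)"
      unfolding R_def \<zeta>_def
      by (rule vertex_term_partial_fractions) (use m v a b ab in auto)
    also have "\<dots> = (\<Sum>k\<in>UNIV. g v (\<epsilon> v k))"
      using \<epsilon>[OF v] by (simp add: g_def bij_betw_def)
    also have "\<dots> = (\<Sum>e\<in>Ed v. g v e)"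
      by (rule sum.reindex_bij_betw[OF \<epsilon>[OF v]])
    finally show ?thesis .
  qed
  have cancel: "g u e + g v e = 0" if u: "u \<in> V" "e \<in> Ed u" and v: "v \<in> V" "e \<in> Ed v" and "u \<noteq> v" for u v e
  proof -
    define k where "k = inv_into UNIV (\<epsilon> u) e"
    define k' where "k' = inv_into UNIV (\<epsilon> v) e"
    have eq: "\<epsilon> u k = e" "\<epsilon> v k' = e"
      unfolding k_def k'_def using \<epsilon>[OF u(1)] \<epsilon>[OF v(1)] u(2) v(2)
      by (metis bij_betw_inv_into_right)+
    with edge[OF u(1) v(1) \<open>u \<noteq> v\<close>, of k k'] obtain c \<sigma> where
      k': "W v k' = - W u k" and c: "v = u + c *\<^sub>R W u k" and \<sigma>: "bij \<sigma>" "\<sigma> k = k'"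
      and proj: "\<And>j. j \<noteq> k \<Longrightarrow> \<exists>\<mu>>0. \<exists>\<nu>. W v (\<sigma> j) = \<mu> *\<^sub>R W u j + \<nu> *\<^sub>R W u k"
      by auto
    \<comment> \<open>Changing the sign of the generator leaves the quotient unchanged: both flags
      of the edge have their pole at the same point of the line.\<close>
    have \<zeta>: "\<zeta> v k' = \<zeta> u k" by (simp add: \<zeta>_def k' pairing_minus_left)
    have 0: "pairing (W u k) (\<zeta> u k) = 0"
      unfolding \<zeta>_def pairing_add_smult_right using b[OF u(1), of k] by simp
    have 1: "pairing (W u j) (\<zeta> u k) \<noteq> 0" if "j \<noteq> k" for j
      using ab[OF u(1) that] b[OF u(1), of k] unfolding \<zeta>_def pairing_add_smult_right
      by (simp add: field_simps)
    have p: "t *\<^sub>R v = t *\<^sub>R u + (t * c) *\<^sub>R W u k" by (simp add: c scaleR_add_right)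
    have "box_gf (t *\<^sub>R u) (W u) (\<zeta> u k) *
        (\<Prod>j\<in>UNIV-{k}. inverse (exp_quot (pairing (W u j) (\<zeta> u k)))) =
      box_gf (t *\<^sub>R v) (W v) (\<zeta> u k) *
        (\<Prod>j\<in>UNIV-{\<sigma> k}. inverse (exp_quot (pairing (W v j) (\<zeta> u k))))"
      by (rule edge_term_eq[OF W[OF u(1)] W[OF v(1)] int[OF u(1)] int[OF v(1)] \<sigma>(1) _ p proj 0 1])
        (simp add: \<sigma>(2) k')
    \<comment> \<open>The numerators agree, and the denominator \<open>pairing (W v k') z\<close> is
      the negative of \<open>pairing (W u k) z\<close>.\<close>
    then have "R v k' = - R u k"
      by (simp add: R_def \<zeta> \<sigma>(2) k' pairing_minus_left)
    then show ?thesis by (simp add: g_def k_def k'_def)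
  qed
  have "finite (\<Union>v\<in>V. Ed v)"
    using V bij_betw_finite[OF \<epsilon>] by simp
  \<comment> \<open>Double counting of flags; by \<open>ends\<close>, each inner sum after the swap
    runs over exactly two vertices.\<close>
  have "(\<Sum>v\<in>V. \<Sum>e\<in>Ed v. g v e) = (\<Sum>v\<in>V. \<Sum>e\<in>{e \<in> (\<Union>v\<in>V. Ed v). e \<in> Ed v}. g v e)"
    by (intro sum.cong) auto
  also have "\<dots> = (\<Sum>e\<in>(\<Union>v\<in>V. Ed v). \<Sum>v\<in>{v\<in>V. e \<in> Ed v}. g v e)"
    by (rule sum.swap_restrict) fact+
  also have "\<dots> = 0"
  proof (rule sum.neutral, safe)
    fix e v assume v: "v \<in> V" "e \<in> Ed v"
    from ends[OF this] obtain u where u: "u \<noteq> v" "{x\<in>V. e \<in> Ed x} = {u, v}" by blast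
    then have "u \<in> V" "e \<in> Ed u" by blast+
    with cancel[OF _ _ v u(1)] show "(\<Sum>v\<in>{v\<in>V. e \<in> Ed v}. g v e) = 0"
      using u by simp
  qed
  finally show ?thesis by (simp add: flags)
qed

section \<open>Vertex cones of simple rational polytopes\<close>

lemma finite_vertices:
  assumes "polytope P"
  shows "finite (vertices P)"
  using finite_polyhedron_extreme_points[OF polytope_imp_polyhedron[OF assms]]
  by (simp add: vertices_def)

lemma polytope_eq_hull_vertices:
  assumes "polytope P"
  shows "P = convex hull (vertices P)"
  using Krein_Milman_Minkowski[of P] polytope_imp_compact[OF assms] polytope_imp_convex[OF assms]
  by (simp add: vertices_def)

text \<open>A compact convex set of dimension one is a segment, and the extreme points of a face are
  the vertices of \<open>P\<close> on it.\<close>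

lemma edge_of_polytope_eq_segment:
  assumes P: "polytope P" and e: "e edge_of P"
  obtains u v where "u \<noteq> v" "e = closed_segment u v" "vertices P \<inter> e = {u, v}"
proof -
  have face: "e face_of P" and dim: "aff_dim e = 1" using e by (auto simp: edge_of_def)
  have "polytope e" using face_of_polytope_polytope[OF P face] .
  moreover have "e \<noteq> {}" using dim by auto
  ultimately obtain u v where uv: "e = closed_segment u v"
    using compact_convex_collinear_segment[of e] dim
    by (auto simp: collinear_aff_dim polytope_imp_compact polytope_imp_convex)
  have "u \<noteq> v" using dim uv by auto
  moreover have "vertices P \<inter> e = {x. x extreme_point_of e}"
    using extreme_point_of_face[OF face] by (auto simp: vertices_def)
  then have "vertices P \<inter> e = {u, v}" by (auto simp: uv extreme_point_of_segment)
  ultimately show ?thesis using that uv by blast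
qed

lemma edge_at_vertex:
  assumes P: "polytope P" and v: "v \<in> vertices P" and e: "e \<in> edges_at P v"
  obtains u where "u \<noteq> v" "e = closed_segment v u" "vertices P \<inter> e = {v, u}"
proof -
  have "e edge_of P" "v \<in> e" using e by (auto simp: edges_at_def)
  from edge_of_polytope_eq_segment[OF P this(1)] obtain a b where
    ab: "a \<noteq> b" "e = closed_segment a b" "vertices P \<inter> e = {a, b}" .
  with v \<open>v \<in> e\<close> have "v = a \<or> v = b" by blast
  then show ?thesis
  proof
    assume "v = a" then show ?thesis using that[of b] ab by auto
  next
    assume "v = b" then show ?thesis
      using that[of a] ab by (auto simp: closed_segment_commute insert_commute)
  qed
qed

text \<open>Take the smallest face through \<open>x\<close>: were \<open>x\<close> on its relative
  boundary, a facet of it would be a smaller face containing \<open>x\<close>.\<close>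

lemma ex_face_rel_interior:
  fixes P :: "'a::euclidean_space set"
  assumes P: "polytope P" and x: "x \<in> P"
  obtains F where "F face_of P" "x \<in> rel_interior F"
proof -
  define F where "F = \<Inter>{T. T face_of P \<and> x \<in> T}"
  have "P face_of P" using P by (simp add: face_of_refl polytope_imp_convex)
  then have F: "F face_of P" unfolding F_def using x by (intro face_of_Inter) auto
  have "x \<in> F" by (simp add: F_def)
  have "x \<in> rel_interior F"
  proof (rule ccontr)
    assume "x \<notin> rel_interior F"
    moreover have "polyhedron F"
      using face_of_polytope_polytope[OF P F] by (rule polytope_imp_polyhedron)
    ultimately obtain T where T: "T facet_of F" "x \<in> T"
      using rel_boundary_of_polyhedron[of F] \<open>x \<in> F\<close> by blast
    then have "T face_of P" using F by (meson facet_of_imp_face_of face_of_trans)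
    with T(2) have "F \<subseteq> T" by (auto simp: F_def)
    with T(1) show False
      by (metis facet_of_imp_subset facet_of_irrefl subset_antisym)
  qed
  with F that show ?thesis by blast
qed

text \<open>The extreme points of a slice of a polytope lie on faces of dimension at most one,
  since a face of higher dimension still contains a segment of the slice around the point.\<close>
lemma extreme_point_of_slice:
  fixes P :: "'a::euclidean_space set"
  assumes P: "polytope P" and x: "x extreme_point_of (P \<inter> {y. a \<bullet> y = b})"
  obtains F where "F face_of P" "x \<in> F" "aff_dim F \<le> 1"
proof -
  have xP: "x \<in> P" and ax: "a \<bullet> x = b" using x by (auto simp: extreme_point_of_def)
  obtain F where F: "F face_of P" and xF: "x \<in> rel_interior F"
    using ex_face_rel_interior[OF P xP] .
  then obtain \<epsilon> where \<epsilon>: "\<epsilon> > 0" "ball x \<epsilon> \<inter> affine hull F \<subseteq> F" and "x \<in> F"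
    by (auto simp: mem_rel_interior_ball)
  have "aff_dim F \<le> 1"
  proof (rule ccontr)
    assume "\<not> aff_dim F \<le> 1"
    let ?A = "affine hull F \<inter> {y. a \<bullet> y = b}"
    have xA: "x \<in> ?A" using \<open>x \<in> F\<close> ax by (simp add: hull_inc)
    \<comment> \<open>A hyperplane through \<open>x\<close> lowers the dimension by at most one, so
      here the section is more than the point \<open>x\<close>.\<close>
    have "aff_dim ?A \<noteq> 0"
      using aff_dim_affine_Int_hyperplane[OF affine_affine_hull[of F], of a b] xA \<open>\<not> aff_dim F \<le> 1\<close>
      by (auto split: if_splits)
    then have "?A \<noteq> {x}" by auto
    with xA obtain y where y: "y \<in> ?A" "y \<noteq> x" by blast
    define \<delta> where "\<delta> = \<epsilon> / (2 * norm (y - x))"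
    have \<delta>: "\<delta> > 0" "\<delta> * norm (y - x) < \<epsilon>" using \<epsilon>(1) y(2) by (auto simp: \<delta>_def)
    have mem: "x + s *\<^sub>R (y - x) \<in> P \<inter> {y. a \<bullet> y = b}" if "\<bar>s\<bar> = \<delta>" for s
    proof -
      have "(1 - s) *\<^sub>R x + s *\<^sub>R y \<in> ?A"
        using xA y(1) by (intro mem_affine) (auto intro: affine_Int affine_hyperplane)
      then have "x + s *\<^sub>R (y - x) \<in> ?A" by (simp add: algebra_simps)
      moreover have "x + s *\<^sub>R (y - x) \<in> ball x \<epsilon>" using \<delta> that by (simp add: dist_norm)
      ultimately show ?thesis using \<epsilon>(2) face_of_imp_subset[OF F] by blast
    qed
    have "x + \<delta> *\<^sub>R (y - x) \<noteq> x + (- \<delta>) *\<^sub>R (y - x)"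
      using \<delta>(1) y(2) by (simp only: add_left_cancel scaleR_cancel_right) simp
    moreover have "midpoint (x + \<delta> *\<^sub>R (y - x)) (x + (- \<delta>) *\<^sub>R (y - x)) = x"
      by (simp add: midpoint_eq_iff)
    ultimately have "x \<in> open_segment (x + \<delta> *\<^sub>R (y - x)) (x + (- \<delta>) *\<^sub>R (y - x))"
      by (metis midpoint_in_open_segment)
    then show False
      using x mem[of \<delta>] mem[of "- \<delta>"] \<delta>(1) by (auto simp: extreme_point_of_def)
  qed
  with that F \<open>x \<in> F\<close> show ?thesis by blast
qed

text \<open>Cut \<open>P\<close> by a hyperplane separating \<open>v\<close> from the other
  vertices. The extreme points of the slice lie on edges at \<open>v\<close>, so the slice lies in
  the cone \<open>D\<close> translated to \<open>v\<close>, and every other vertex is on a ray from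
  \<open>v\<close> through the slice.\<close>

lemma vertex_cone_subset:
  fixes P :: "'a::euclidean_space set"
  assumes P: "polytope P" and v: "v \<in> vertices P"
    and D: "convex_cone D"
    and edges: "\<And>e u. e \<in> edges_at P v \<Longrightarrow> u \<in> e \<Longrightarrow> u - v \<in> D"
    and p: "p \<in> P"
  shows "p - v \<in> D"
proof -
  have D0: "0 \<in> D" and Dadd: "\<And>x y. x \<in> D \<Longrightarrow> y \<in> D \<Longrightarrow> x + y \<in> D"
    and Dscale: "\<And>c x. 0 \<le> c \<Longrightarrow> x \<in> D \<Longrightarrow> c *\<^sub>R x \<in> D" and Dconv: "convex D"
    using D
    by (simp_all add: convex_cone_contains_0 convex_cone_add convex_cone_scaleR convex_cone_def)
  define X where "X = vertices P - {v}"
  \<comment> \<open>\<open>v\<close> is extreme, so \<open>P\<close> without \<open>v\<close> is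
    still convex and contains the hull of the other vertices.\<close>
  have "v \<notin> convex hull X"
  proof -
    have "v extreme_point_of P" using v by (simp add: vertices_def)
    then have "convex (P - {v})"
      using extreme_point_of_stillconvex polytope_imp_convex[OF P] by blast
    moreover have "X \<subseteq> P - {v}" by (auto simp: X_def vertices_def extreme_point_of_def)
    ultimately have "convex hull X \<subseteq> P - {v}" by (simp add: hull_minimal)
    then show ?thesis by blast
  qed
  moreover have "closed (convex hull X)"
    using finite_vertices[OF P] by (simp add: X_def compact_imp_closed finite_imp_compact_convex_hull)
  ultimately obtain a b where av: "a \<bullet> v < b" and aX: "\<And>x. x \<in> convex hull X \<Longrightarrow> b < a \<bullet> x"
    using separating_hyperplane_closed_point[of "convex hull X" v] by auto
  let ?Q = "P \<inter> {y. a \<bullet> y = b}"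
  have ext: "x - v \<in> D" if x: "x extreme_point_of ?Q" for x
  proof -
    have ax: "a \<bullet> x = b" using x by (auto simp: extreme_point_of_def)
    obtain F where F: "F face_of P" "x \<in> F" "aff_dim F \<le> 1"
      using extreme_point_of_slice[OF P x] .
    \<comment> \<open>A face of dimension 0 would be a vertex on the hyperplane, but each vertex
      lies strictly on one side of it.\<close>
    have "aff_dim F \<noteq> 0"
    proof
      assume "aff_dim F = 0"
      then have "F = {x}" using F(2) by (auto simp: aff_dim_eq_0)
      then have "x \<in> vertices P" using F(1) by (simp add: face_of_singleton vertices_def)
      then have "x = v \<or> x \<in> convex hull X"
        by (cases "x = v") (auto simp: X_def hull_inc)
      then show False using av aX ax by fastforce
    qed
    moreover have "aff_dim F \<ge> 0" using aff_dim_subset[of "{x}" F] F(2) by simp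
    ultimately have "F edge_of P" using F by (auto simp: edge_of_def)
    from edge_of_polytope_eq_segment[OF P this] obtain u w where
      "u \<noteq> w" and uw: "F = closed_segment u w" "vertices P \<inter> F = {u, w}" .
    \<comment> \<open>Otherwise both ends of the edge, and with them \<open>x\<close>, would lie
      strictly beyond the hyperplane.\<close>
    have "v \<in> F"
    proof (rule ccontr)
      assume "v \<notin> F"
      then have "{u, w} \<subseteq> X" using uw(2) by (auto simp: X_def)
      then have "closed_segment u w \<subseteq> convex hull X"
        by (simp add: segment_convex_hull hull_mono)
      with aX ax F(2) uw(1) show False by force
    qed
    then show ?thesis using edges[of F x] \<open>F edge_of P\<close> F(2) by (simp add: edges_at_def)
  qed
  have Q: "?Q \<subseteq> (+) v ` D"
  proof -
    have "?Q = convex hull {x. x extreme_point_of ?Q}"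
      using P by (intro Krein_Milman_Minkowski)
        (auto intro: compact_Int_closed convex_Int simp: polytope_imp_compact polytope_imp_convex
          closed_hyperplane convex_hyperplane)
    moreover have "convex hull {x. x extreme_point_of ?Q} \<subseteq> (+) v ` D"
    proof (rule hull_minimal)
      show "{x. x extreme_point_of ?Q} \<subseteq> (+) v ` D"
        using ext by (auto simp: image_iff) (metis add_diff_cancel_left' diff_add_cancel add.commute)
      show "convex ((+) v ` D)" using Dconv by (simp add: convex_translation)
    qed
    ultimately show ?thesis by simp
  qed
  have "vertices P \<subseteq> (+) v ` D"
  proof
    fix x assume x: "x \<in> vertices P"
    have "x - v \<in> D"
    proof (cases "x = v")
      case False
      then have "x \<in> X" using x by (simp add: X_def)
      then have "b < a \<bullet> x" using aX by (simp add: hull_inc)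
      \<comment> \<open>The parameter at which the segment from \<open>v\<close> to \<open>x\<close>
        crosses the hyperplane.\<close>
      define \<tau> where "\<tau> = (b - a \<bullet> v) / (a \<bullet> x - a \<bullet> v)"
      have \<tau>: "0 < \<tau>" "\<tau> < 1" using av \<open>b < a \<bullet> x\<close> by (auto simp: \<tau>_def)
      define h where "h = v + \<tau> *\<^sub>R (x - v)"
      have "h = (1 - \<tau>) *\<^sub>R v + \<tau> *\<^sub>R x" by (simp add: h_def algebra_simps)
      moreover have "v \<in> P" "x \<in> P" using v x by (auto simp: vertices_def extreme_point_of_def)
      ultimately have "h \<in> P"
        using \<tau> polytope_imp_convex[OF P] by (auto simp: convex_alt)
      moreover have "a \<bullet> h = b"
        using av \<open>b < a \<bullet> x\<close> by (simp add: h_def \<tau>_def inner_add_right inner_diff_right)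
      ultimately have "h - v \<in> D" using Q by auto
      then have "(1 / \<tau>) *\<^sub>R (h - v) \<in> D" using \<tau> by (intro Dscale) auto
      then show ?thesis using \<tau> by (simp add: h_def)
    qed (simp add: D0)
    then show "x \<in> (+) v ` D" by (auto simp: image_iff intro!: bexI[of _ "x - v"])
  qed
  then have "convex hull (vertices P) \<subseteq> (+) v ` D"
    using Dconv by (intro hull_minimal) (simp_all add: convex_translation)
  with p polytope_eq_hull_vertices[OF P] show ?thesis by auto
qed

section \<open>Matching the cones at the two ends of an edge\<close>

lemma nonneg_sum_eq_0D:
  fixes f :: "'k::finite \<Rightarrow> real"
  assumes "(\<Sum>i\<in>UNIV. f i) = 0" "\<And>i. 0 \<le> f i"
  shows "f i = 0"
  using assms sum_nonneg_eq_0_iff[of UNIV f] by simp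

text \<open>The two coefficient matrices are nonnegative and, modulo \<open>A k\<close>, inverse to each other,
  hence monomial.\<close>
lemma cone_generators_match:
  fixes A B :: "'k::finite \<Rightarrow> 'a::real_vector"
  assumes A: "indep_family A" and k: "B k' = - A k"
    and AB: "\<And>j. \<exists>c \<nu>. (\<forall>i. 0 \<le> c i) \<and> A j = (\<Sum>i\<in>UNIV. c i *\<^sub>R B i) + \<nu> *\<^sub>R A k"
    and BA: "\<And>i. \<exists>c \<nu>. (\<forall>j. 0 \<le> c j) \<and> B i = (\<Sum>j\<in>UNIV. c j *\<^sub>R A j) + \<nu> *\<^sub>R A k"
  shows "\<exists>\<sigma>. bij \<sigma> \<and> \<sigma> k = k' \<and>
    (\<forall>j. j \<noteq> k \<longrightarrow> (\<exists>\<mu>>0. \<exists>\<nu>. B (\<sigma> j) = \<mu> *\<^sub>R A j + \<nu> *\<^sub>R A k))"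
proof -
  obtain C \<nu> where C: "\<And>j i. 0 \<le> C j i" "\<And>j. A j = (\<Sum>i\<in>UNIV. C j i *\<^sub>R B i) + \<nu> j *\<^sub>R A k"
    using AB by metis
  obtain D \<tau> where D: "\<And>i j. 0 \<le> D i j" "\<And>i. B i = (\<Sum>j\<in>UNIV. D i j *\<^sub>R A j) + \<tau> i *\<^sub>R A k"
    using BA by metis
  \<comment> \<open>Row \<open>k'\<close> of \<open>D\<close> expands \<open>- A k\<close> modulo
    \<open>A k\<close>, so it vanishes outside column \<open>k\<close>.\<close>
  have Dk': "D k' l = 0" if "l \<noteq> k" for l
  proof -
    have "(\<Sum>j\<in>UNIV. ((D k')(k := D k' k + (\<tau> k' + 1))) j *\<^sub>R A j) = 0"
    proof -
      have 0: "(\<Sum>j\<in>UNIV. D k' j *\<^sub>R A j) + \<tau> k' *\<^sub>R A k = - A k"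
        using D(2)[of k'] k by simp
      show ?thesis
        unfolding sum_scaleR_upd_add unfolding scaleR_add_left add.assoc[symmetric] 0 by simp
    qed
    from indep_familyD[OF A this, of l] that show ?thesis by simp
  qed
  \<comment> \<open>Substituting one expansion into the other shows that the product of
    \<open>C\<close> and \<open>D\<close> agrees with the identity outside column \<open>k\<close>;
    that column absorbs the multiples of \<open>A k\<close>.\<close>
  have CD: "(\<Sum>i\<in>UNIV. C j i * D i l) = (if l = j then 1 else 0)" if "l \<noteq> k" for j l
  proof -
    define S where "S l = (\<Sum>i\<in>UNIV. C j i * D i l)" for l
    define \<theta> where "\<theta> = (\<Sum>i\<in>UNIV. C j i * \<tau> i) + \<nu> j"
    have "(\<Sum>l\<in>UNIV. S l *\<^sub>R A l) = (\<Sum>i\<in>UNIV. \<Sum>l\<in>UNIV. (C j i * D i l) *\<^sub>R A l)"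
      unfolding S_def scaleR_sum_left by (rule sum.swap)
    moreover have "A j = (\<Sum>i\<in>UNIV. \<Sum>l\<in>UNIV. (C j i * D i l) *\<^sub>R A l) + \<theta> *\<^sub>R A k"
    proof -
      have CB: "C j i *\<^sub>R B i = (\<Sum>l\<in>UNIV. (C j i * D i l) *\<^sub>R A l) + (C j i * \<tau> i) *\<^sub>R A k" for i
        by (subst D(2)) (simp add: scaleR_add_right scaleR_sum_right)
      have "A j = (\<Sum>i\<in>UNIV. C j i *\<^sub>R B i) + \<nu> j *\<^sub>R A k" by (rule C(2))
      also have "(\<Sum>i\<in>UNIV. C j i *\<^sub>R B i) =
          (\<Sum>i\<in>UNIV. \<Sum>l\<in>UNIV. (C j i * D i l) *\<^sub>R A l) + (\<Sum>i\<in>UNIV. C j i * \<tau> i) *\<^sub>R A k"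
        unfolding CB sum.distrib scaleR_sum_left ..
      finally show ?thesis by (simp only: \<theta>_def scaleR_add_left add.assoc)
    qed
    moreover have "A j = (\<Sum>l\<in>UNIV. (if l = j then 1 else 0) *\<^sub>R A l)"
    proof -
      have "(\<Sum>l\<in>UNIV. (if l = j then 1 else 0) *\<^sub>R A l) = (\<Sum>l\<in>UNIV. if l = j then A l else 0)"
        by (rule sum.cong) auto
      then show ?thesis by simp
    qed
    ultimately have "(\<Sum>l\<in>UNIV. (if l = j then 1 else 0) *\<^sub>R A l) =
        (\<Sum>l\<in>UNIV. (S(k := S k + \<theta>)) l *\<^sub>R A l)"
      unfolding sum_scaleR_upd_add by simp
    from indep_family_unique[OF A this, of l] that show ?thesis by (simp add: S_def)
  qed
  \<comment> \<open>The diagonal entry at \<open>j\<close> provides an \<open>i\<close> with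
    \<open>C j i\<close> and \<open>D i j\<close> positive. In the other columns nonnegative terms
    add up to 0, so row \<open>i\<close> of \<open>D\<close> lives in columns \<open>j\<close> and
    \<open>k\<close> only.\<close>
  have "\<exists>i. i \<noteq> k' \<and> 0 < D i j \<and> (\<forall>l. l \<noteq> j \<and> l \<noteq> k \<longrightarrow> D i l = 0)" if j: "j \<noteq> k" for j
  proof -
    have "(\<Sum>i\<in>UNIV. C j i * D i j) \<noteq> 0" using CD[OF j, of j] by simp
    then obtain i where i: "C j i * D i j \<noteq> 0" by (meson sum.not_neutral_contains_not_neutral)
    then have pos: "0 < C j i" "0 < D i j"
      using C(1)[of j i] D(1)[of i j] by (auto simp: less_le)
    have "D i l = 0" if l: "l \<noteq> j" "l \<noteq> k" for l
    proof -
      have "(\<Sum>i\<in>UNIV. C j i * D i l) = 0" using CD[OF l(2), of j] l(1) by simp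
      then have "C j i * D i l = 0"
        by (rule nonneg_sum_eq_0D) (simp add: C(1) D(1))
      then show ?thesis using pos by simp
    qed
    moreover have "i \<noteq> k'" using pos Dk'[OF j] by auto
    ultimately show ?thesis using pos by blast
  qed
  then obtain s where s: "\<And>j. j \<noteq> k \<Longrightarrow> s j \<noteq> k' \<and> 0 < D (s j) j \<and>
      (\<forall>l. l \<noteq> j \<and> l \<noteq> k \<longrightarrow> D (s j) l = 0)"
    by metis
  define \<sigma> where "\<sigma> = s(k := k')"
  have "inj \<sigma>"
  proof (rule injI, rule ccontr)
    fix i j assume eq: "\<sigma> i = \<sigma> j" and ne: "i \<noteq> j"
    show False
    proof (cases "i = k \<or> j = k")
      case True
      then show False using eq ne s by (auto simp: \<sigma>_def split: if_splits)
    next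
      case False
      then have "s i = s j" "i \<noteq> k" "j \<noteq> k" using eq by (auto simp: \<sigma>_def)
      with s[of j] ne have "D (s i) i = 0" by simp
      with s[OF \<open>i \<noteq> k\<close>] show False by simp
    qed
  qed
  then have "bij \<sigma>" by (simp add: bij_def finite_UNIV_inj_surj)
  moreover have "\<exists>\<mu>>0. \<exists>\<nu>. B (\<sigma> j) = \<mu> *\<^sub>R A j + \<nu> *\<^sub>R A k" if j: "j \<noteq> k" for j
  proof -
    have D0: "D (s j) l = 0" if "l \<noteq> j" "l \<noteq> k" for l using s[OF j] that by blast
    have eq: "D (s j) l *\<^sub>R A l = (if l = j then D (s j) j *\<^sub>R A j else 0) +
        (if l = k then D (s j) k *\<^sub>R A k else 0)" for l
    proof -
      consider "l = j" | "l = k" | "l \<noteq> j" "l \<noteq> k" by blast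
      then show ?thesis using j D0 by cases simp_all
    qed
    have "(\<Sum>l\<in>UNIV. D (s j) l *\<^sub>R A l) =
        (\<Sum>l\<in>UNIV. (if l = j then D (s j) j *\<^sub>R A j else 0) +
          (if l = k then D (s j) k *\<^sub>R A k else 0))"
      by (rule sum.cong[OF refl]) (rule eq)
    then have "(\<Sum>l\<in>UNIV. D (s j) l *\<^sub>R A l) = D (s j) j *\<^sub>R A j + D (s j) k *\<^sub>R A k"
      by (simp add: sum.distrib)
    then have "B (\<sigma> j) = D (s j) j *\<^sub>R A j + (D (s j) k + \<tau> (s j)) *\<^sub>R A k"
      using j D(2)[of "s j"] by (simp add: \<sigma>_def scaleR_add_left)
    then show ?thesis using s[OF j] by blast
  qed
  ultimately show ?thesis by (intro exI[of _ \<sigma>]) (simp add: \<sigma>_def)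
qed

section \<open>Primitive vectors along rational edges\<close>

lemma finite_Rats_common_denominator:
  assumes "finite A" "A \<subseteq> (\<rat> :: real set)"
  obtains N :: nat where "0 < N" "\<forall>x\<in>A. real N * x \<in> \<int>"
proof -
  have "\<exists>N::nat. 0 < N \<and> (\<forall>x\<in>A. real N * x \<in> \<int>)"
    using assms
  proof induction
    case empty
    then show ?case by (intro exI[of _ 1]) simp
  next
    case (insert x A)
    then obtain N :: nat where N: "0 < N" "\<forall>y\<in>A. real N * y \<in> \<int>" by auto
    obtain a b where b: "b > 0" "x = of_int a / of_int b"
      using insert.prems by (auto elim: Rats_cases')
    define M where "M = nat b * N"
    have "real M * x = real N * of_int a" using b by (simp add: M_def)
    then have "real M * x \<in> \<int>" by simp
    moreover have "real M * y \<in> \<int>" if "y \<in> A" for y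
    proof -
      have "real N * y \<in> \<int>" using N(2) that by blast
      then have "of_int b * (real N * y) \<in> \<int>" by (rule Ints_mult[OF Ints_of_int])
      also have "of_int b * (real N * y) = real M * y" using b by (simp add: M_def)
      finally show ?thesis .
    qed
    ultimately show ?case using N(1) b(1) by (intro exI[of _ M]) (simp add: M_def)
  qed
  with that show ?thesis by blast
qed

lemma primitive_vector_nonzero: "primitive_vector w \<Longrightarrow> w \<noteq> 0"
proof
  assume "primitive_vector w" "w = 0"
  then obtain u :: "int ^ 'a" where "\<And>i. u $ i = 0" and g: "Gcd (range (\<lambda>i. u $ i)) = 1"
    by (auto simp: primitive_vector_def vec_eq_iff)
  then have "range (\<lambda>i. u $ i) = {0}" by auto
  with g show False by simp
qed

lemma primitive_vector_in_lattice: "primitive_vector w \<Longrightarrow> w \<in> integer_lattice"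
  by (auto simp: primitive_vector_def integer_lattice_def)

lemma primitive_vector_uminus:
  assumes "primitive_vector w"
  shows "primitive_vector (- w)"
proof -
  from assms obtain u where u: "w = (\<chi> i. of_int (u $ i))" "Gcd (range (\<lambda>i. u $ i)) = 1"
    by (auto simp: primitive_vector_def)
  have "range (\<lambda>i. (- u) $ i) = (*) (-1) ` range (\<lambda>i. u $ i)" by (auto simp: image_image)
  then have "Gcd (range (\<lambda>i. (- u) $ i)) = 1"
    using Gcd_mult[of "-1" "range (\<lambda>i. u $ i)"] u(2) by simp
  moreover have "- w = (\<chi> i. of_int ((- u) $ i))" by (simp add: u(1) vec_eq_iff)
  ultimately show ?thesis unfolding primitive_vector_def by blast
qed

text \<open>Proportionality gives \<open>u $ i * u' $ l = u' $ i * u $ l\<close> for all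
  \<open>l\<close>; taking gcds over \<open>l\<close> yields equal absolute values of
  \<open>u $ i\<close> and \<open>u' $ i\<close>, hence \<open>c = 1\<close>.\<close>

lemma primitive_vector_unique:
  assumes w: "primitive_vector w" and w': "primitive_vector w'" and eq: "w' = c *\<^sub>R w" and c: "c > 0"
  shows "w' = w"
proof -
  from w obtain u where u: "w = (\<chi> i. of_int (u $ i))" "Gcd (range (\<lambda>i. u $ i)) = 1"
    by (auto simp: primitive_vector_def)
  from w' obtain u' where u': "w' = (\<chi> i. of_int (u' $ i))" "Gcd (range (\<lambda>i. u' $ i)) = 1"
    by (auto simp: primitive_vector_def)
  have uu: "real_of_int (u' $ i) = c * real_of_int (u $ i)" for i
    using eq by (simp add: u(1) u'(1) vec_eq_iff)
  from primitive_vector_nonzero[OF w] obtain i where i: "u $ i \<noteq> 0"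
    by (auto simp: u(1) vec_eq_iff)
  have "real_of_int (u $ i * u' $ l) = real_of_int (u' $ i * u $ l)" for l
    by (simp add: uu)
  then have "u $ i * u' $ l = u' $ i * u $ l" for l by (simp only: of_int_eq_iff)
  then have "(*) (u $ i) ` range (\<lambda>l. u' $ l) = (*) (u' $ i) ` range (\<lambda>l. u $ l)"
    by (simp add: image_image)
  then have "normalize (u $ i * 1) = normalize (u' $ i * 1)"
    using Gcd_mult[of "u $ i" "range (\<lambda>l. u' $ l)"] Gcd_mult[of "u' $ i" "range (\<lambda>l. u $ l)"]
    by (simp only: u(2) u'(2))
  then have "\<bar>u $ i\<bar> = \<bar>u' $ i\<bar>" by simp
  then have "\<bar>real_of_int (u $ i)\<bar> = c * \<bar>real_of_int (u $ i)\<bar>"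
    using arg_cong[OF uu[of i], of abs] c by (simp add: abs_mult flip: of_int_abs)
  then have "c = 1" using i by simp
  with eq show ?thesis by simp
qed

lemma ex_primitive_vector:
  fixes x :: "real ^ 'd"
  assumes x: "x \<noteq> 0" and rat: "\<And>i. x $ i \<in> \<rat>"
  obtains w c where "0 < c" "primitive_vector w" "x = c *\<^sub>R w"
proof -
  obtain N :: nat where N: "0 < N" "\<forall>y\<in>range (\<lambda>i. x $ i). real N * y \<in> \<int>"
    by (rule finite_Rats_common_denominator[of "range (\<lambda>i. x $ i)"]) (use rat in auto)
  define u where "u i = \<lfloor>real N * x $ i\<rfloor>" for i
  have u: "real_of_int (u i) = real N * x $ i" for i
    using N(2) by (simp add: u_def)
  define g where "g = Gcd (range u)"
  obtain i where "x $ i \<noteq> 0" using x by (auto simp: vec_eq_iff)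
  with u[of i] N(1) have "u i \<noteq> 0" by auto
  then have "g \<noteq> 0" by (auto simp: g_def Gcd_0_iff)
  moreover have "g \<ge> 0" by (simp add: g_def)
  ultimately have g: "g > 0" by simp
  define u' where "u' i = u i div g" for i
  have uu': "u i = g * u' i" for i
    unfolding u'_def by (rule dvd_mult_div_cancel[symmetric]) (simp add: g_def)
  have "g = Gcd ((*) g ` range u')"
    unfolding image_image by (simp add: g_def[symmetric] uu'[symmetric])
  also have "\<dots> = g * Gcd (range u')"
    using g by (simp add: Gcd_mult abs_mult)
  finally have "Gcd (range u') = 1" using g by simp
  then have prim: "primitive_vector (\<chi> i. of_int (u' i) :: real ^ 'd)"
    unfolding primitive_vector_def by (intro exI[of _ "\<chi> i. u' i"]) simp
  have "x = (of_int g / real N) *\<^sub>R (\<chi> i. of_int (u' i))"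
  proof -
    have "real N * x $ i = of_int g * of_int (u' i)" for i
      using u[of i] by (simp add: uu')
    then show ?thesis using N(1) by (simp add: vec_eq_iff field_simps)
  qed
  with prim that[of "of_int g / real N"] g N(1) show ?thesis by simp
qed

text \<open>Any competitor in the description operator points along the same ray, so it is a
  positive multiple of \<open>w\<close> and equals \<open>w\<close> by uniqueness.\<close>

lemma primitive_edge_vector_eqI:
  assumes w: "primitive_vector w" and c: "0 < c" and e: "e = closed_segment v (v + c *\<^sub>R w)"
  shows "primitive_edge_vector v e = w"
  unfolding primitive_edge_vector_def
proof (rule the_equality)
  show "primitive_vector w \<and> (\<exists>c>0. v + c *\<^sub>R w \<in> e)"
    using w c e by blast
next
  fix w' assume "primitive_vector w' \<and> (\<exists>c>0. v + c *\<^sub>R w' \<in> e)"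
  then obtain c' where w': "primitive_vector w'" and c': "c' > 0" "v + c' *\<^sub>R w' \<in> e" by blast
  then obtain s where s: "0 \<le> s" "v + c' *\<^sub>R w' = (1 - s) *\<^sub>R v + s *\<^sub>R (v + c *\<^sub>R w)"
    unfolding e in_segment by blast
  then have eq: "c' *\<^sub>R w' = (s * c) *\<^sub>R w" by (simp add: algebra_simps)
  have "w' = (1 / c') *\<^sub>R (c' *\<^sub>R w')" using c' by simp
  then have "w' = (s * c / c') *\<^sub>R w" unfolding eq by simp
  moreover from this have "s \<noteq> 0" using primitive_vector_nonzero[OF w'] by auto
  ultimately show "w' = w"
    using primitive_vector_unique[OF w w', of "s * c / c'"] s(1) c c' by simp
qed

lemma primitive_edge_vector_edge:
  fixes P :: "(real ^ 'd) set"
  assumes P: "rational_polytope P" and v: "v \<in> vertices P" and e: "e \<in> edges_at P v"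
  obtains c where "0 < c" "primitive_vector (primitive_edge_vector v e)"
    "vertices P \<inter> e = {v, v + c *\<^sub>R primitive_edge_vector v e}"
    "e = closed_segment v (v + c *\<^sub>R primitive_edge_vector v e)"
proof -
  have "polytope P" using P by (simp add: rational_polytope_def)
  from edge_at_vertex[OF this v e] obtain u where
    u: "u \<noteq> v" "e = closed_segment v u" "vertices P \<inter> e = {v, u}" .
  then have "u \<in> vertices P" by blast
  then have rat: "(u - v) $ i \<in> \<rat>" for i
    using P v by (simp add: rational_polytope_def)
  have "u - v \<noteq> 0" using u(1) by simp
  from ex_primitive_vector[OF this rat]
  obtain w c where w: "0 < c" "primitive_vector w" "u - v = c *\<^sub>R w" .
  then have uv: "u = v + c *\<^sub>R w" by (simp add: algebra_simps)
  have pe: "primitive_edge_vector v e = w"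
    using primitive_edge_vector_eqI[OF w(2,1)] u(2) unfolding uv by blast
  show ?thesis
    using that[OF w(1)] w(2) u(2,3) unfolding pe uv by blast
qed

text \<open>The nonnegative combinations of \<open>W\<close> form a convex cone which contains every
  edge at \<open>v\<close> translated by \<open>- v\<close>, so \<open>vertex_cone_subset\<close>
  applies.\<close>

lemma primitive_edge_family_cone:
  fixes P :: "(real ^ 'd) set"
  assumes P: "rational_polytope P" and v: "v \<in> vertices P" and W: "primitive_edge_family P v W"
    and p: "p \<in> P"
  shows "\<exists>c. (\<forall>k. 0 \<le> c k) \<and> p - v = (\<Sum>k\<in>UNIV. c k *\<^sub>R W k)"
proof -
  obtain \<epsilon> where \<epsilon>: "bij_betw \<epsilon> UNIV (edges_at P v)" "\<And>k. W k = primitive_edge_vector v (\<epsilon> k)"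
    using W by (auto simp: primitive_edge_family_def)
  define D where "D = {x. \<exists>c. (\<forall>k. 0 \<le> c k) \<and> x = (\<Sum>k\<in>UNIV. c k *\<^sub>R W k)}"
  have DI: "(\<Sum>k\<in>UNIV. c k *\<^sub>R W k) \<in> D" if "\<And>k. 0 \<le> c k" for c
    using that by (auto simp: D_def)
  have "p - v \<in> D"
  proof (rule vertex_cone_subset[OF _ v _ _ p])
    show "polytope P" using P by (simp add: rational_polytope_def)
    show "convex_cone D"
      unfolding convex_cone_iff
    proof (intro conjI ballI allI impI)
      show "0 \<in> D" using DI[of "\<lambda>_. 0"] by simp
      fix x assume "x \<in> D"
      then obtain c where c: "\<And>k. 0 \<le> c k" "x = (\<Sum>k\<in>UNIV. c k *\<^sub>R W k)" by (auto simp: D_def)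
      show "a *\<^sub>R x \<in> D" if "0 \<le> a" for a
        using DI[of "\<lambda>k. a * c k"] that c by (simp add: scaleR_sum_right)
      fix y assume "y \<in> D"
      then obtain c' where c': "\<And>k. 0 \<le> c' k" "y = (\<Sum>k\<in>UNIV. c' k *\<^sub>R W k)" by (auto simp: D_def)
      show "x + y \<in> D"
        using DI[of "\<lambda>k. c k + c' k"] c c' by (simp add: scaleR_add_left sum.distrib)
    qed
    fix e u assume e: "e \<in> edges_at P v" and u: "u \<in> e"
    have "e \<in> range \<epsilon>" using e \<epsilon>(1) by (simp add: bij_betw_def)
    then obtain k where k: "e = \<epsilon> k" by (rule imageE)
    obtain c where c: "0 < c" "e = closed_segment v (v + c *\<^sub>R W k)"
      using primitive_edge_vector_edge[OF P v e] unfolding k \<epsilon>(2) by metis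
    from u c(2) obtain s where s: "0 \<le> s" "u = (1 - s) *\<^sub>R v + s *\<^sub>R (v + c *\<^sub>R W k)"
      by (auto simp: in_segment)
    have "u - v = (s * c) *\<^sub>R W k" unfolding s(2) by (simp add: algebra_simps)
    also have "\<dots> = (\<Sum>l\<in>UNIV. ((\<lambda>_. 0)(k := s * c)) l *\<^sub>R W l)"
      using sum_scaleR_upd_add[of "\<lambda>_. 0" k "s * c" W] by simp
    also have "\<dots> \<in> D" using s(1) c(1) by (intro DI) simp
    finally show "u - v \<in> D" .
  qed
  then show ?thesis by (auto simp: D_def)
qed

text \<open>By the cone description, \<open>P\<close> lies in \<open>v\<close> plus the span of
  \<open>W\<close>. As \<open>P\<close> is full-dimensional, the generators span the space, and
  their number makes them independent.\<close>

lemma primitive_edge_family_indep: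
  fixes P :: "(real ^ 'd) set"
  assumes P: "rational_polytope P" and dim: "aff_dim P = int CARD('d)"
    and v: "v \<in> vertices P" and W: "primitive_edge_family P v W"
  shows "indep_family W"
proof -
  have "x \<in> span (range W)" for x
  proof -
    have "P \<subseteq> (+) v ` span (range W)"
    proof
      fix p assume "p \<in> P"
      from primitive_edge_family_cone[OF P v W this] obtain c where
        "p - v = (\<Sum>k\<in>UNIV. c k *\<^sub>R W k)" by blast
      also have "\<dots> \<in> span (range W)" by (intro span_sum span_scale span_base) auto
      finally show "p \<in> (+) v ` span (range W)" by (auto simp: image_iff intro!: bexI[of _ "p - v"])
    qed
    then have "affine hull P \<subseteq> (+) v ` span (range W)"
      by (intro hull_minimal) (auto simp: affine_translation[symmetric] subspace_imp_affine)
    moreover have "affine hull P = UNIV" using dim by (simp flip: aff_dim_eq_full)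
    ultimately have "v + x \<in> (+) v ` span (range W)" by blast
    then show ?thesis by auto
  qed
  then have span: "UNIV \<subseteq> span (range W)" by blast
  have dimU: "dim (UNIV :: (real ^ 'd) set) = CARD('d)" by simp
  have "CARD('d) \<le> card (range W)"
    using span_card_ge_dim[of "range W" UNIV] span dimU by simp
  then have card: "card (range W) = CARD('d)" using card_image_le[of UNIV W] by simp
  then have inj: "inj W" by (simp add: eq_card_imp_inj_on)
  have indep: "independent (range W)"
    by (rule card_le_dim_spanning[where V = UNIV]) (use span card in auto)
  show ?thesis
    unfolding indep_family_def
  proof (intro allI impI)
    fix c k assume "(\<Sum>k\<in>UNIV. c k *\<^sub>R W k) = 0"
    then have "(\<Sum>x\<in>range W. c (inv W x) *\<^sub>R x) = 0"
      by (simp add: sum.reindex[OF inj] inj)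
    from independentD[OF indep _ _ this, of "W k"] inj show "c k = 0" by simp
  qed
qed

section \<open>Vanishing of the coefficients\<close>

text \<open>The far end of the edge along \<open>U j\<close> belongs to \<open>P\<close>, hence to
  the cone at \<open>v\<close>; replacing the apex \<open>v\<close> by \<open>u\<close> costs only a
  multiple of \<open>x\<close>. With the common edge direction as \<open>x\<close> this gives the
  hypotheses of \<open>cone_generators_match\<close>.\<close>

lemma translated_cone_generators:
  fixes P :: "(real ^ 'd) set"
  assumes P: "rational_polytope P" and u: "u \<in> vertices P" and v: "v \<in> vertices P"
    and U: "primitive_edge_family P u U" and W: "primitive_edge_family P v W"
    and uv: "v = u + a *\<^sub>R x"
  shows "\<exists>c \<nu>. (\<forall>i. 0 \<le> c i) \<and> U j = (\<Sum>i\<in>UNIV. c i *\<^sub>R W i) + \<nu> *\<^sub>R x"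
proof -
  obtain \<epsilon> where \<epsilon>: "bij_betw \<epsilon> UNIV (edges_at P u)" "\<And>k. U k = primitive_edge_vector u (\<epsilon> k)"
    using U by (auto simp: primitive_edge_family_def)
  have "\<epsilon> j \<in> edges_at P u" using bij_betwE[OF \<epsilon>(1)] by blast
  from primitive_edge_vector_edge[OF P u this] obtain c where
    c: "0 < c" "vertices P \<inter> \<epsilon> j = {u, u + c *\<^sub>R U j}"
    unfolding \<epsilon>(2) by metis
  then have "u + c *\<^sub>R U j \<in> P" by (auto simp: vertices_def extreme_point_of_def)
  from primitive_edge_family_cone[OF P v W this] obtain d where
    d: "\<forall>i. 0 \<le> d i" "u + c *\<^sub>R U j - v = (\<Sum>i\<in>UNIV. d i *\<^sub>R W i)"
    by blast
  have "U j = (1 / c) *\<^sub>R (c *\<^sub>R U j)" using c(1) by simp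
  also have "c *\<^sub>R U j = (\<Sum>i\<in>UNIV. d i *\<^sub>R W i) + a *\<^sub>R x"
    unfolding d(2)[symmetric] uv by simp
  also have "(1 / c) *\<^sub>R \<dots> = (\<Sum>i\<in>UNIV. (d i / c) *\<^sub>R W i) + (a / c) *\<^sub>R x"
    by (simp add: scaleR_add_right scaleR_sum_right)
  finally show ?thesis using d(1) c(1) by (intro exI[of _ "\<lambda>i. d i / c"] exI[of _ "a / c"]) simp
qed

text \<open>Up to sign, each summand comes from the integer-point transform of the vertex cone at
  \<open>t *\<^sub>R v\<close> multiplied by \<open>x ^ CARD('d)\<close>, so the negative powers of
  x in Brion's sum cancel. The proof supplies the edge structure of \<open>P\<close> to
  \<open>sum_vertex_terms_eq_0\<close>.\<close>

lemma brion_coefficients_eq_0: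
  fixes P :: "(real ^ 'd) set" and w :: "real ^ 'd \<Rightarrow> 'd \<Rightarrow> real ^ 'd"
  assumes dim: "aff_dim P = int CARD('d)" and P: "rational_polytope P"
    and w: "\<And>v. v \<in> vertices P \<Longrightarrow> primitive_edge_family P v (w v)"
    and z: "\<And>v k. v \<in> vertices P \<Longrightarrow> pairing (w v k) z \<noteq> 0"
    and m: "m < CARD('d)"
  shows "(\<Sum>v\<in>vertices P. fps_nth (box_gf (t *\<^sub>R v) (w v) z *
    (\<Prod>k\<in>UNIV. inverse (exp_quot (pairing (w v k) z)))) m) = 0"
proof -
  have poly: "polytope P" using P by (simp add: rational_polytope_def)
  have "\<forall>v\<in>vertices P. \<exists>\<epsilon>. bij_betw \<epsilon> UNIV (edges_at P v) \<and>
      (\<forall>k. w v k = primitive_edge_vector v (\<epsilon> k))"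
    using w by (simp add: primitive_edge_family_def)
  then obtain \<epsilon> where \<epsilon>: "\<And>v. v \<in> vertices P \<Longrightarrow> bij_betw (\<epsilon> v) UNIV (edges_at P v)"
    and w_eq: "\<And>v k. v \<in> vertices P \<Longrightarrow> w v k = primitive_edge_vector v (\<epsilon> v k)"
    by metis
  have \<epsilon>_in: "\<epsilon> v k \<in> edges_at P v" if "v \<in> vertices P" for v k
    using bij_betwE[OF \<epsilon>[OF that]] by blast
  have prim: "primitive_vector (w v k)" if v: "v \<in> vertices P" for v k
    unfolding w_eq[OF v] by (rule primitive_edge_vector_edge[OF P v \<epsilon>_in[OF v]])
  show ?thesis
  proof (rule sum_vertex_terms_eq_0[where \<epsilon> = \<epsilon> and Ed = "edges_at P"])
    show "finite (vertices P)" by (rule finite_vertices[OF poly])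
    show "indep_family (w v)" if "v \<in> vertices P" for v
      by (rule primitive_edge_family_indep[OF P dim that w[OF that]])
    show "w v k \<in> integer_lattice" if "v \<in> vertices P" for v k
      by (rule primitive_vector_in_lattice[OF prim[OF that]])
  next
    fix v e assume v: "v \<in> vertices P" and e: "e \<in> edges_at P v"
    from edge_at_vertex[OF poly v e] obtain u where
      u: "u \<noteq> v" "e = closed_segment v u" "vertices P \<inter> e = {v, u}" .
    have "{x \<in> vertices P. e \<in> edges_at P x} = vertices P \<inter> e"
      using e by (auto simp: edges_at_def)
    with u show "\<exists>u. u \<noteq> v \<and> {x \<in> vertices P. e \<in> edges_at P x} = {u, v}" by auto
  next
    fix u v k k' assume u: "u \<in> vertices P" and v: "v \<in> vertices P" and "u \<noteq> v"
      and eq: "\<epsilon> u k = \<epsilon> v k'"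
    from primitive_edge_vector_edge[OF P u \<epsilon>_in[OF u, of k]] obtain c where
      c: "0 < c" "vertices P \<inter> \<epsilon> u k = {u, u + c *\<^sub>R w u k}"
        "\<epsilon> u k = closed_segment u (u + c *\<^sub>R w u k)"
      unfolding w_eq[OF u] by metis
    have "v \<in> \<epsilon> v k'" using \<epsilon>_in[OF v] by (simp add: edges_at_def)
    then have vu: "v = u + c *\<^sub>R w u k" using c(2) v \<open>u \<noteq> v\<close> eq by auto
    have uv: "u = v + (- c) *\<^sub>R w u k" by (simp add: vu)
    \<comment> \<open>The same segment read from its other end; uniqueness of the primitive vector
      then gives \<open>- w u k\<close>.\<close>
    have "\<epsilon> v k' = closed_segment v (v + c *\<^sub>R (- w u k))"
      using c(3) eq by (simp add: vu closed_segment_commute)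
    then have k': "w v k' = - w u k"
      unfolding w_eq[OF v]
      by (rule primitive_edge_vector_eqI[OF primitive_vector_uminus[OF prim[OF u]] c(1)])
    show "w v k' = - w u k \<and> (\<exists>c. v = u + c *\<^sub>R w u k) \<and>
      (\<exists>\<sigma>. bij \<sigma> \<and> \<sigma> k = k' \<and> (\<forall>j. j \<noteq> k \<longrightarrow>
        (\<exists>\<mu>>0. \<exists>\<nu>. w v (\<sigma> j) = \<mu> *\<^sub>R w u j + \<nu> *\<^sub>R w u k)))"
    proof (intro conjI exI[of _ c] vu k' cone_generators_match)
      show "indep_family (w u)" by (rule primitive_edge_family_indep[OF P dim u w[OF u]])
      show "\<exists>c \<nu>. (\<forall>i. 0 \<le> c i) \<and> w u j = (\<Sum>i\<in>UNIV. c i *\<^sub>R w v i) + \<nu> *\<^sub>R w u k" for j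
        by (rule translated_cone_generators[OF P u v w[OF u] w[OF v] vu])
      show "\<exists>c \<nu>. (\<forall>i. 0 \<le> c i) \<and> w v j = (\<Sum>i\<in>UNIV. c i *\<^sub>R w u i) + \<nu> *\<^sub>R w u k" for j
        by (rule translated_cone_generators[OF P v u w[OF v] w[OF u] uv])
    qed
  qed (use m z \<epsilon> in auto)
qed

section \<open>Dependence on the dilation parameter\<close>

text \<open>The substitution \<open>n = q + t *\<^sub>R v\<close> splits off one exponential and
  leads back from lattice points of the cell to the points \<open>q\<close> of the theorem.\<close>

lemma box_gf_eq_translated:
  "box_gf (t *\<^sub>R v) W z = fps_exp (of_real t * pairing v z) *
     (\<Sum>q\<in>translated_lattice_points t v W. fps_exp (pairing q z))"
proof -
  have "bij_betw (\<lambda>q. q + t *\<^sub>R v) (translated_lattice_points t v W) (box_points (t *\<^sub>R v) W)"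
    by (rule bij_betw_byWitness[where f' = "\<lambda>n. n - t *\<^sub>R v"])
      (auto simp: translated_lattice_points_def box_points_def)
  from sum.reindex_bij_betw[OF this, of "\<lambda>n. fps_exp (pairing n z)"]
  have "box_gf (t *\<^sub>R v) W z =
      (\<Sum>q\<in>translated_lattice_points t v W. fps_exp (pairing (q + t *\<^sub>R v) z))"
    by (simp add: box_gf_def)
  then show ?thesis
    by (simp add: pairing_add_left pairing_scaleR_left fps_exp_add_mult sum_distrib_left mult.commute)
qed

text \<open>Changing \<open>t\<close> by \<open>s\<close> translates the lattice by one of its own
  vectors, which maps it to itself.\<close>

lemma translated_lattice_points_periodic:
  assumes "s *\<^sub>R v \<in> integer_lattice"
  shows "translated_lattice_points (t + s) v W = translated_lattice_points t v W"
proof -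
  have "(\<lambda>x. x - (t + s) *\<^sub>R v) ` integer_lattice = (\<lambda>x. x - t *\<^sub>R v) ` integer_lattice"
  proof (intro equalityI image_subsetI)
    fix x :: "real ^ 'a" assume x: "x \<in> integer_lattice"
    show "x - (t + s) *\<^sub>R v \<in> (\<lambda>x. x - t *\<^sub>R v) ` integer_lattice"
      by (rule image_eqI[where x = "x - s *\<^sub>R v"])
        (simp_all add: scaleR_add_left x assms integer_lattice_diff)
    show "x - t *\<^sub>R v \<in> (\<lambda>x. x - (t + s) *\<^sub>R v) ` integer_lattice"
      by (rule image_eqI[where x = "x + s *\<^sub>R v"])
        (simp_all add: scaleR_add_left x assms integer_lattice_add)
  qed
  then show ?thesis by (simp add: translated_lattice_points_def)
qed

lemma sum_fps_exp_nth:
  fixes f :: "'a \<Rightarrow> complex"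
  shows "(\<Sum>q\<in>A. f q ^ n) = fact n * fps_nth (\<Sum>q\<in>A. fps_exp (f q)) n"
  by (simp add: fps_sum_nth sum_distrib_left)

theorem theorem3:
  fixes P :: "(real ^ 'd) set"
    and w :: "real ^ 'd \<Rightarrow> 'd \<Rightarrow> real ^ 'd"
    and z :: "complex ^ 'd"
    and t :: real
  assumes dim: "aff_dim P = int CARD('d)"
    and simple: "simple_polytope P"
    and rational: "rational_polytope P"
    and w: "\<And>v. v \<in> vertices P \<Longrightarrow> primitive_edge_family P v (w v)"
    and z: "\<And>v k. v \<in> vertices P \<Longrightarrow>
              pairing (w v k) z \<notin> range (\<lambda>n::int. 2 * of_real pi * \<i> * of_int n)"
    and t: "t > 0"
  shows "(\<forall>m \<le> CARD('d) - 1.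
            0 = (\<Sum>k=0..m. of_nat (m choose k) *
                  (\<Sum>v\<in>vertices P.
                     barnes_poly k (of_real t * pairing v z) (edge_pairings (w v) z) *
                     (\<Sum>q\<in>translated_lattice_points t v (w v). pairing q z ^ (m - k)))))
       \<and> (\<forall>m \<le> CARD('d) - 1. \<forall>r \<le> m.
            0 = (\<Sum>v\<in>vertices P. pairing v z ^ r *
                  (\<Sum>j=0..m-r.
                     barnes_number j (edge_pairings (w v) z) / (fact j * fact (m - r - j)) *
                     (\<Sum>q\<in>translated_lattice_points t v (w v). pairing q z ^ (m - r - j)))))"
proof -
  have nz: "pairing (w v k) z \<noteq> 0" if "v \<in> vertices P" for v k
    using z[OF that, of k] by (auto simp: image_iff dest!: spec[of _ "0::int"])
  define B where "B v = (\<Prod>k\<in>UNIV. inverse (exp_quot (pairing (w v k) z)))" for v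
  define G where "G t v = (\<Sum>q\<in>translated_lattice_points t v (w v). fps_exp (pairing q z))" for t v
  have zero: "(\<Sum>v\<in>vertices P. fps_nth (fps_exp (of_real t * pairing v z) * (B v * G t v)) m) = 0"
    if "m \<le> CARD('d) - 1" for m and t :: real
  proof -
    \<comment> \<open>\<open>CARD('d) - 1\<close> is a truncated difference; positivity of the
      cardinality makes the bound strict.\<close>
    have "m < CARD('d)" using that zero_less_card_finite[where 'a = 'd] by linarith
    from brion_coefficients_eq_0[OF dim rational w nz this, of t] show ?thesis
      by (simp only: box_gf_eq_translated flip: B_def G_def) (simp only: mult_ac)
  qed
  have barnes: "barnes_poly k s (edge_pairings (w v) z) = fact k * fps_nth (fps_exp s * B v) k"
    if "v \<in> vertices P" for k s v
    using barnes_poly_eq_fps_nth[of "edge_pairings (w v) z" k s] nz[OF that]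
    by (simp add: edge_pairings_def B_def)
  have powers: "(\<Sum>q\<in>translated_lattice_points t v (w v). pairing q z ^ n) =
      fact n * fps_nth (G t v) n" for v n
    by (simp add: sum_fps_exp_nth G_def)
  have "(\<Sum>k=0..m. of_nat (m choose k) *
        (\<Sum>v\<in>vertices P. barnes_poly k (of_real t * pairing v z) (edge_pairings (w v) z) *
           (\<Sum>q\<in>translated_lattice_points t v (w v). pairing q z ^ (m - k)))) = 0"
    if m: "m \<le> CARD('d) - 1" for m
  proof -
    have "of_nat (m choose k) *
        (\<Sum>v\<in>vertices P. barnes_poly k (of_real t * pairing v z) (edge_pairings (w v) z) *
           (\<Sum>q\<in>translated_lattice_points t v (w v). pairing q z ^ (m - k))) =
        fact m * (\<Sum>v\<in>vertices P. fps_nth (fps_exp (of_real t * pairing v z) * B v) k *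
           fps_nth (G t v) (m - k))" if "k \<in> {0..m}" for k
    proof -
      \<comment> \<open>The binomial coefficient merges the factorials of the Barnes polynomial and
        of the power sum into \<open>fact m\<close>, so the sum over \<open>k\<close> becomes a
        Cauchy product.\<close>
      have binom: "fact k * fact (m - k) * (of_nat (m choose k) :: complex) = fact m"
        using arg_cong[OF binomial_fact_lemma[of k m], of complex_of_nat] that by simp
      have "of_nat (m choose k) * (barnes_poly k (of_real t * pairing v z) (edge_pairings (w v) z) *
           (\<Sum>q\<in>translated_lattice_points t v (w v). pairing q z ^ (m - k))) =
        fact m * (fps_nth (fps_exp (of_real t * pairing v z) * B v) k * fps_nth (G t v) (m - k))"
        if v: "v \<in> vertices P" for v
        unfolding barnes[OF v] powers binom[symmetric] by (simp only: mult_ac)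
      then show ?thesis
        unfolding sum_distrib_left[of _ _ "vertices P"] by (rule sum.cong[OF refl])
    qed
    then have "(\<Sum>k=0..m. of_nat (m choose k) *
        (\<Sum>v\<in>vertices P. barnes_poly k (of_real t * pairing v z) (edge_pairings (w v) z) *
           (\<Sum>q\<in>translated_lattice_points t v (w v). pairing q z ^ (m - k)))) =
        (\<Sum>k=0..m. fact m * (\<Sum>v\<in>vertices P. fps_nth (fps_exp (of_real t * pairing v z) * B v) k *
           fps_nth (G t v) (m - k)))"
      by (rule sum.cong[OF refl])
    also have "\<dots> = fact m * (\<Sum>v\<in>vertices P. fps_nth (fps_exp (of_real t * pairing v z) * B v * G t v) m)"
      unfolding sum_distrib_left[symmetric] fps_mult_nth[of _ "G t _"]
      by (subst sum.swap) (rule refl)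
    also have "\<dots> = 0" using zero[OF m, of t] by (simp only: mult.assoc) simp
    finally show ?thesis .
  qed
  moreover have "(\<Sum>v\<in>vertices P. pairing v z ^ r *
        (\<Sum>j=0..m-r. barnes_number j (edge_pairings (w v) z) / (fact j * fact (m - r - j)) *
           (\<Sum>q\<in>translated_lattice_points t v (w v). pairing q z ^ (m - r - j)))) = 0"
    if m: "m \<le> CARD('d) - 1" and r: "r \<le> m" for m r
  proof -
    \<comment> \<open>With \<open>G\<close> frozen at \<open>t\<close>, identity (a) divided by
      \<open>fact m\<close> becomes the polynomial \<open>p\<close> in the remaining occurrences of
      the dilation parameter, with coefficients \<open>c r / fact r\<close>.\<close>
    define c where "c r = (\<Sum>v\<in>vertices P. pairing v z ^ r * fps_nth (B v * G t v) (m - r))" for r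
    define p where "p = (\<Sum>r=0..m. monom (c r / fact r) r)"
    have "polytope P" using rational by (simp add: rational_polytope_def)
    then have fin: "finite ((\<lambda>(v, i). v $ i) ` (vertices P \<times> UNIV))"
      by (intro finite_imageI finite_cartesian_product finite_vertices) simp_all
    have rat: "(\<lambda>(v, i). v $ i) ` (vertices P \<times> UNIV) \<subseteq> \<rat>"
      using rational by (auto simp: rational_polytope_def)
    from finite_Rats_common_denominator[OF fin rat] obtain N :: nat where N: "0 < N"
      "\<forall>x\<in>(\<lambda>(v, i). v $ i) ` (vertices P \<times> UNIV). real N * x \<in> \<int>" .
    \<comment> \<open>At \<open>t + real n * real N\<close> the translated lattices are those at
      \<open>t\<close>, so (a) there says that one and the same polynomial \<open>p\<close>
      vanishes.\<close>
    have root: "poly p (of_real (t + real n * real N)) = 0" for n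
    proof -
      define t' where "t' = t + real n * real N"
      have per: "G t' v = G t v" if v: "v \<in> vertices P" for v
      proof -
        have "real n * (real N * v $ i) \<in> \<int>" for i
          by (rule Ints_mult) (use N(2) v in auto)
        then have "(real n * real N) *\<^sub>R v \<in> integer_lattice"
          by (simp add: integer_lattice_def mult.assoc)
        then show ?thesis by (simp add: G_def t'_def translated_lattice_points_periodic)
      qed
      have "0 = (\<Sum>v\<in>vertices P. fps_nth (fps_exp (of_real t' * pairing v z) * (B v * G t v)) m)"
        using zero[OF m, of t'] by (simp add: per)
      also have "\<dots> = (\<Sum>v\<in>vertices P. \<Sum>r=0..m. of_real t' ^ r / fact r *
          (pairing v z ^ r * fps_nth (B v * G t v) (m - r)))"
        unfolding fps_mult_nth[of "fps_exp _"] by (simp add: power_mult_distrib mult.assoc)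
      also have "\<dots> = (\<Sum>r=0..m. \<Sum>v\<in>vertices P. of_real t' ^ r / fact r *
          (pairing v z ^ r * fps_nth (B v * G t v) (m - r)))"
        by (rule sum.swap)
      also have "\<dots> = poly p (of_real t')"
        unfolding sum_distrib_left[symmetric] c_def[symmetric]
        by (simp add: p_def poly_sum poly_monom mult.commute)
      finally show ?thesis by (simp add: t'_def)
    qed
    have "p = 0"
    proof (rule ccontr)
      assume "p \<noteq> 0"
      then have "finite {x. poly p x = 0}" by (rule poly_roots_finite)
      moreover have "range (\<lambda>n. of_real (t + real n * real N)) \<subseteq> {x. poly p x = 0}"
        using root by auto
      moreover have "inj (\<lambda>n. complex_of_real (t + real n * real N))"
        using N(1) by (intro injI) (simp only: of_real_eq_iff, simp)
      ultimately show False using finite_subset range_inj_infinite by blast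
    qed
    moreover have "poly.coeff p r = c r / fact r"
    proof -
      have "poly.coeff p r = (\<Sum>i=0..m. if i = r then c r / fact r else 0)"
        unfolding p_def coeff_sum by (rule sum.cong) auto
      then show ?thesis using r by simp
    qed
    ultimately have "c r = 0" by simp
    \<comment> \<open>The denominators cancel the factorials of the Barnes numbers and of the power
      sums, leaving a Cauchy product; hence (b) is \<open>c r = 0\<close>.\<close>
    moreover have "(\<Sum>j=0..m-r. barnes_number j (edge_pairings (w v) z) / (fact j * fact (m - r - j)) *
           (\<Sum>q\<in>translated_lattice_points t v (w v). pairing q z ^ (m - r - j))) =
        fps_nth (B v * G t v) (m - r)" if "v \<in> vertices P" for v
      by (simp add: fps_mult_nth[of "B v"] barnes_number_def barnes[OF that] powers)
    ultimately show ?thesis by (simp add: c_def)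
  qed
  ultimately show ?thesis by simp
qed

end
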